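(* Let $d\in\mathbb{N}$, $p\in(0,\infty]$, $\alpha\in(0,\infty)$. Let $\boldsymbol{\ell}:\mathbb{N}\to\mathbb{N}_{\ge 2}\cup\{\infty\}$ and $\boldsymbol{c}:\mathbb{N}\to\mathbb{N}\cup\{\infty\}$ be non-decreasing, and assume that there are $\theta\ge 0$ and $\kappa\in\mathbb{R}$ with $\boldsymbol{c}(n)\asymp n^{\theta}\cdot(\ln(2n))^{\kappa}$, i.e. there are constants $K_1,K_2>0$ with $K_1 n^\theta(\ln(2n))^\kappa\le \boldsymbol{c}(n)\le K_2 n^\theta(\ln(2n))^\kappa$ for all $n\in\mathbb{N}$. Set $\boldsymbol{\ell}^\ast:=\sup_{n\in\mathbb{N}}\boldsymbol{\ell}(n)\in\mathbb{N}_{\ge2}\cup\{\infty\}$ and $\gamma^\ast:=\theta\cdot\boldsymbol{\ell}^\ast+\lfloor\boldsymbol{\ell}^\ast/2\rfloor\in[1,\infty]$. Then: (i) If $\alpha>\frac{d}{p}\cdot\gamma^\ast$, then the embedding $A^{\alpha,p}_{\boldsymbol{\ell},\boldsymbol{c}}([0,1]^d)\hookrightarrow C([0,1]^d)$ holds. (ii) If $\alpha<\frac{d}{p}\cdot\gamma^\ast$, then the embedding $A^{\alpha,p}_{\boldsymbol{\ell},\boldsymbol{c}}([0,1]^d)\hookrightarrow C([0,1]^d)$ does not hold.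
   Context: $\mathbb{N}=\{1,2,3,\dots\}$. Conventions: $d/p:=0$ if $p=\infty$; $0\cdot\infty:=0$; $\lfloor\infty/2\rfloor:=\infty$. Neural networks: a neural network is a tuple $\Phi=((A_1,b_1),\dots,(A_L,b_L))$ with $L\in\mathbb{N}$, $A_j\in\mathbb{R}^{N_j\times N_{j-1}}$, $b_j\in\mathbb{R}^{N_j}$, $N_0,\dots,N_L\in\mathbb{N}$. Put $L(\Phi):=L$ (number of layers), $d_{\mathrm{in}}(\Phi):=N_0$, $d_{\mathrm{out}}(\Phi):=N_L$, $W(\Phi):=\sum_{j=1}^L(\|A_j\|_{\ell^0}+\|b_j\|_{\ell^0})$, where $\|\cdot\|_{\ell^0}$ counts non-zero entries, and $\|\Phi\|_{\mathcal{NN}}:=\max_j\max\{\|A_j\|_\infty,\|b_j\|_\infty\}$, where $\|\cdot\|_\infty$ is the largest absolute value of an entry. With the ReLU $\varrho(x)=\max\{0,x\}$ acting componentwise and $T_jx=A_jx+b_j$, the realization is $R_\varrho\Phi:=T_L\circ(\varrho\circ T_{L-1})\circ\cdots\circ(\varrho\circ T_1):\mathbb{R}^{N_0}\to\mathbb{R}^{N_L}$. Approximation spaces: $\Sigma_n^{\boldsymbol{\ell},\boldsymbol{c}}$ is the set of all $R_\varrho\Phi$ with $d_{\mathrm{in}}(\Phi)=d$, $d_{\mathrm{out}}(\Phi)=1$, $W(\Phi)\le n$, $L(\Phi)\le\boldsymbol{\ell}(n)$, $\|\Phi\|_{\mathcal{NN}}\le\boldsymbol{c}(n)$. For measurable $f:[0,1]^d\to\mathbb{R}$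 let $d_p(f,\Sigma):=\inf_{g\in\Sigma}\|f-g\|_{L^p([0,1]^d)}$ and $$\Gamma_{\alpha,p}(f):=\max\Big\{\|f\|_{L^p([0,1]^d)},\ \sup_{n\in\mathbb{N}}\big[n^\alpha\cdot d_p(f,\Sigma_n^{\boldsymbol{\ell},\boldsymbol{c}})\big]\Big\}\in[0,\infty],$$ $\|f\|_{A^{\alpha,p}_{\boldsymbol{\ell},\boldsymbol{c}}}:=\inf\{t>0:\Gamma_{\alpha,p}(f/t)\le1\}\in[0,\infty]$, and $A^{\alpha,p}_{\boldsymbol{\ell},\boldsymbol{c}}([0,1]^d):=\{f\in L^p([0,1]^d):\|f\|_{A^{\alpha,p}_{\boldsymbol{\ell},\boldsymbol{c}}}<\infty\}$ (a quasi-normed space). $C([0,1]^d)$ carries the supremum norm. An embedding $X\hookrightarrow Y$ means that every $f\in X$ belongs to $Y$ (after possibly changing $f$ on a null set) and there is $C>0$ with $\|f\|_Y\le C\|f\|_X$ for all $f\in X$. *)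

theory Defs
  imports
    "HOL-Analysis.Analysis"
    "HOL-Probability.Essential_Supremum"
    "HOL-Library.Extended_Nat"
    "Jordan_Normal_Form.Matrix"
begin

text \<open>
  Both HOL-Analysis and Jordan-Normal-Form provide a type of vectors written with the same infix
  indexing syntax, so the indexing functions are written in prefix form: \<open>vec_nth\<close> for points
  of \<open>real ^ 'd\<close> and \<open>vec_index\<close> for the vectors of variable length used inside networks.
\<close>

type_synonym network = "(real mat \<times> real vec) list"

text \<open>\<open>N 0, \<dots>, N L\<close> are the numbers of neurons; list index \<open>j\<close> holds the layer \<open>(A\<^sub>j\<^sub>+\<^sub>1, b\<^sub>j\<^sub>+\<^sub>1)\<close>.\<close>

definition is_network :: "network \<Rightarrow> bool" where
  "is_network \<Phi> \<longleftrightarrow> \<Phi> \<noteq> [] \<and>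
     (\<exists>N :: nat \<Rightarrow> nat. (\<forall>j \<le> length \<Phi>. N j \<ge> 1) \<and>
        (\<forall>j < length \<Phi>. fst (\<Phi> ! j) \<in> carrier_mat (N (Suc j)) (N j) \<and>
                         snd (\<Phi> ! j) \<in> carrier_vec (N (Suc j))))"

definition num_layers :: "network \<Rightarrow> nat" where
  "num_layers \<Phi> = length \<Phi>"

definition d_in :: "network \<Rightarrow> nat" where
  "d_in \<Phi> = dim_col (fst (hd \<Phi>))"

definition d_out :: "network \<Rightarrow> nat" where
  "d_out \<Phi> = dim_row (fst (last \<Phi>))"

definition l0_mat :: "real mat \<Rightarrow> nat" where
  "l0_mat A = card {(i, j). i < dim_row A \<and> j < dim_col A \<and> A $$ (i, j) \<noteq> 0}"

definition l0_vec :: "real vec \<Rightarrow> nat" where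
  "l0_vec b = card {i. i < dim_vec b \<and> vec_index b i \<noteq> 0}"

definition num_weights :: "network \<Rightarrow> nat" where
  "num_weights \<Phi> = (\<Sum>(A, b) \<leftarrow> \<Phi>. l0_mat A + l0_vec b)"

definition max_mat :: "real mat \<Rightarrow> real" where
  "max_mat A = Max (abs ` elements_mat A)"

definition max_vec :: "real vec \<Rightarrow> real" where
  "max_vec b = Max (abs ` vec_set b)"

definition nn_norm :: "network \<Rightarrow> real" where
  "nn_norm \<Phi> = Max ((\<lambda>(A, b). max (max_mat A) (max_vec b)) ` set \<Phi>)"

definition relu :: "real \<Rightarrow> real" where
  "relu x = max 0 x"

text \<open>The activation is applied after every layer except the last one.\<close>

fun realization :: "network \<Rightarrow> real vec \<Rightarrow> real vec" where
  "realization [] x = x"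
| "realization [(A, b)] x = A *\<^sub>v x + b"
| "realization ((A, b) # l # \<Phi>) x = realization (l # \<Phi>) (map_vec relu (A *\<^sub>v x + b))"

text \<open>
  The dimension \<open>d\<close> is \<open>CARD('d)\<close>. A point of \<open>real ^ 'd\<close> is fed into a network via the
  enumeration \<open>from_nat_into UNIV\<close> of the index type. Permuting the columns of the first
  matrix shows that the class \<open>nn_class\<close> below does not depend on the enumeration.
\<close>

definition input_vec :: "real ^ 'd \<Rightarrow> real vec" where
  "input_vec x = Matrix.vec CARD('d) (\<lambda>i. vec_nth x (from_nat_into UNIV i))"

definition nn_class :: "(nat \<Rightarrow> enat) \<Rightarrow> (nat \<Rightarrow> enat) \<Rightarrow> nat \<Rightarrow> (real ^ 'd \<Rightarrow> real) set" where
  "nn_class ell c n =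
     {(\<lambda>x. vec_index (realization \<Phi> (input_vec x)) 0) | \<Phi>.
        is_network \<Phi> \<and> d_in \<Phi> = CARD('d) \<and> d_out \<Phi> = 1 \<and>
        num_weights \<Phi> \<le> n \<and> enat (num_layers \<Phi>) \<le> ell n \<and>
        ennreal (nn_norm \<Phi>) \<le> ennreal_of_enat (c n)}"

abbreviation unit_cube :: "(real ^ 'd) set" where
  "unit_cube \<equiv> cbox 0 1"

definition Lp_norm :: "'a measure \<Rightarrow> ennreal \<Rightarrow> ('a \<Rightarrow> real) \<Rightarrow> ennreal" where
  "Lp_norm M p f =
     (if p = \<infinity> then esssup M (\<lambda>x. ennreal \<bar>f x\<bar>)
      else let I = (\<integral>\<^sup>+ x. ennreal (\<bar>f x\<bar> powr enn2real p) \<partial>M)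
           in if I = \<infinity> then \<infinity> else ennreal (enn2real I powr (1 / enn2real p)))"

abbreviation Lp_cube_norm :: "ennreal \<Rightarrow> (real ^ 'd \<Rightarrow> real) \<Rightarrow> ennreal" where
  "Lp_cube_norm \<equiv> Lp_norm (lebesgue_on unit_cube)"

definition Lp_cube :: "ennreal \<Rightarrow> (real ^ 'd \<Rightarrow> real) set" where
  "Lp_cube p = {f \<in> borel_measurable (lebesgue_on unit_cube). Lp_cube_norm p f < \<infinity>}"

definition Lp_dist :: "ennreal \<Rightarrow> (real ^ 'd \<Rightarrow> real) \<Rightarrow> (real ^ 'd \<Rightarrow> real) set \<Rightarrow> ennreal" where
  "Lp_dist p f S = (INF g \<in> S. Lp_cube_norm p (\<lambda>x. f x - g x))"

definition approx_Gamma ::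
  "(nat \<Rightarrow> enat) \<Rightarrow> (nat \<Rightarrow> enat) \<Rightarrow> real \<Rightarrow> ennreal \<Rightarrow> (real ^ 'd \<Rightarrow> real) \<Rightarrow> ennreal" where
  "approx_Gamma ell c \<alpha> p f =
     max (Lp_cube_norm p f)
         (SUP n \<in> {1..}. ennreal (real n powr \<alpha>) * Lp_dist p f (nn_class ell c n))"

definition approx_norm ::
  "(nat \<Rightarrow> enat) \<Rightarrow> (nat \<Rightarrow> enat) \<Rightarrow> real \<Rightarrow> ennreal \<Rightarrow> (real ^ 'd \<Rightarrow> real) \<Rightarrow> ennreal" where
  "approx_norm ell c \<alpha> p f =
     (INF t \<in> {t :: real. t > 0 \<and> approx_Gamma ell c \<alpha> p (\<lambda>x. f x / t) \<le> 1}. ennreal t)"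

definition approx_space ::
  "(nat \<Rightarrow> enat) \<Rightarrow> (nat \<Rightarrow> enat) \<Rightarrow> real \<Rightarrow> ennreal \<Rightarrow> (real ^ 'd \<Rightarrow> real) set" where
  "approx_space ell c \<alpha> p = {f \<in> Lp_cube p. approx_norm ell c \<alpha> p f < \<infinity>}"

definition cont_cube :: "(real ^ 'd \<Rightarrow> real) set" where
  "cont_cube = {g. continuous_on unit_cube g}"

definition sup_norm :: "(real ^ 'd \<Rightarrow> real) \<Rightarrow> ennreal" where
  "sup_norm g = (SUP x \<in> unit_cube. ennreal \<bar>g x\<bar>)"

text \<open>
  Elements of the spaces are represented by functions rather than by equivalence classes;
  \<open>g\<close> is \<open>f\<close> after a change on a null set of the cube.
\<close>

definition embeds ::
  "(real ^ 'd \<Rightarrow> real) set \<Rightarrow> ((real ^ 'd \<Rightarrow> real) \<Rightarrow> ennreal) \<Rightarrow>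
   (real ^ 'd \<Rightarrow> real) set \<Rightarrow> ((real ^ 'd \<Rightarrow> real) \<Rightarrow> ennreal) \<Rightarrow> bool" where
  "embeds X normX Y normY \<longleftrightarrow>
     (\<exists>C :: real. C > 0 \<and>
        (\<forall>f \<in> X. \<exists>g \<in> Y. (AE x in lebesgue_on unit_cube. g x = f x) \<and>
                          normY g \<le> ennreal C * normX f))"

definition enat_half :: "enat \<Rightarrow> enat" where
  "enat_half m = (case m of enat k \<Rightarrow> enat (k div 2) | \<infinity> \<Rightarrow> \<infinity>)"

definition ell_star :: "(nat \<Rightarrow> enat) \<Rightarrow> enat" where
  "ell_star ell = (SUP n \<in> {1..}. ell n)"

text \<open>The conventions \<open>0 \<cdot> \<infinity> = 0\<close> and \<open>d / \<infinity> = 0\<close> are those of \<open>ennreal\<close>.\<close>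

definition gamma_star :: "real \<Rightarrow> (nat \<Rightarrow> enat) \<Rightarrow> ennreal" where
  "gamma_star \<theta> ell =
     ennreal \<theta> * ennreal_of_enat (ell_star ell) + ennreal_of_enat (enat_half (ell_star ell))"

end

theory Submission
  imports Defs "HOL-Real_Asymp.Real_Asymp"
begin

text \<open>
  A network with \<open>L\<close> layers, at most \<open>n\<close> non-zero weights and weights of size at most \<open>c\<close> has
  Lipschitz constant at most \<open>c ^ L * n ^ (L div 2)\<close>, hence roughly \<open>n powr \<gamma>\<close>, where \<open>\<gamma>\<close> is \<open>gamma_star \<theta> ell\<close>. A \<open>\<Lambda>\<close>-Lipschitz function \<open>g\<close> on the cube
  satisfies \<open>\<bar>g x\<bar> \<le> \<Lambda> d r + r powr (- d / p) * \<delta>\<close> for all \<open>0 < r \<le> 1\<close>, where \<open>\<delta>\<close> is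
  its \<open>L\<^sup>p\<close> norm. If \<open>\<alpha> > d \<gamma> / p\<close>, then taking \<open>r = n powr (- \<beta>)\<close> with \<open>\<beta>\<close> strictly between
  \<open>\<gamma>\<close> and \<open>\<alpha> p / d\<close> makes the differences of near-best approximants from the classes with
  \<open>n = 2 ^ k\<close> decay geometrically in the supremum norm.

  The Lipschitz bound is sharp up to constants for the spikes \<open>Q * relu (\<beta> - c * (\<Sum>i. x i))\<close>
  at the corner \<open>0\<close> of the cube, and if \<open>\<alpha> < d \<gamma> / p\<close> then spikes of any prescribed height occur
  in the unit ball of the approximation space.
\<close>

section \<open>Lipschitz constants of networks\<close>

text \<open>The threshold comes from the geometry of a single spike. A spike of fixed height a and
  slope S lives on a box of side a / S, so its L^p norm is at most a * (a / S) powr (d / p). With S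
  of order n powr \<gamma> this is of order n powr (- d * \<gamma> / p). Two approximants then
  suffice to put the spike into the unit ball: the spike itself once n is large enough for its
  network, and the zero network before that. In both directions the strict inequality leaves a small
  power of n, which swallows logarithms and constants. Unbounded depth needs no separate analysis:
  for finite p the threshold is then infinite, so the first statement is vacuous and the second
  needs just one sufficiently large finite depth. All spikes are continuous, so what fails is the
  constant of the embedding. Since p < 1 is allowed, only a quasi-triangle inequality is available;
  it is applied to two terms at a time.\<close>

lemma is_network_Cons_iff:
  "is_network ((A, b) # \<Phi>) \<longleftrightarrow>
     dim_row A \<ge> 1 \<and> dim_col A \<ge> 1 \<and> dim_vec b = dim_row A \<and>
     (\<Phi> = [] \<or> is_network \<Phi> \<and> d_in \<Phi> = dim_row A)"
  (is "?L \<longleftrightarrow> ?R")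
proof
  assume ?L
  then obtain N where N: "\<And>j. j \<le> length ((A, b) # \<Phi>) \<Longrightarrow> N j \<ge> 1"
    "\<And>j. j < length ((A, b) # \<Phi>) \<Longrightarrow> fst (((A, b) # \<Phi>) ! j) \<in> carrier_mat (N (Suc j)) (N j) \<and>
       snd (((A, b) # \<Phi>) ! j) \<in> carrier_vec (N (Suc j))"
    unfolding is_network_def by blast
  have A: "A \<in> carrier_mat (N 1) (N 0)" "b \<in> carrier_vec (N 1)"
    using N(2)[of 0] by auto
  have *: "is_network \<Phi> \<and> d_in \<Phi> = dim_row A" if "\<Phi> \<noteq> []"
  proof
    show "is_network \<Phi>"
      unfolding is_network_def
    proof (intro conjI exI[of _ "\<lambda>j. N (Suc j)"] allI impI)
      fix j assume "j < length \<Phi>"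
      with N(2)[of "Suc j"] show "fst (\<Phi> ! j) \<in> carrier_mat (N (Suc (Suc j))) (N (Suc j))"
        "snd (\<Phi> ! j) \<in> carrier_vec (N (Suc (Suc j)))" by auto
    qed (use that N(1) in auto)
    show "d_in \<Phi> = dim_row A"
      using N(2)[of 1] that A by (auto simp: d_in_def hd_conv_nth)
  qed
  have "N 0 \<ge> 1" "N 1 \<ge> 1" using N(1)[of 0] N(1)[of 1] by auto
  moreover have "dim_row A = N 1" "dim_col A = N 0" "dim_vec b = N 1" using A by simp_all
  ultimately have "dim_row A \<ge> 1" "dim_col A \<ge> 1" "dim_vec b = dim_row A" by simp_all
  with * show ?R by blast
next
  assume R: ?R
  show ?L
  proof (cases "\<Phi> = []")
    case True
    have "dim_row A \<ge> 1" "dim_col A \<ge> 1" "dim_vec b = dim_row A"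
      using R by blast+
    moreover from this(3) have "b \<in> carrier_vec (dim_row A)" by (rule carrier_vecI)
    moreover have "A \<in> carrier_mat (dim_row A) (dim_col A)" by simp
    ultimately have *: "A \<in> carrier_mat (dim_row A) (dim_col A)" "b \<in> carrier_vec (dim_row A)"
      "dim_row A \<ge> 1" "dim_col A \<ge> 1" by blast+
    define N where "N = (\<lambda>j :: nat. if j = 0 then dim_col A else dim_row A)"
    have N: "N 0 = dim_col A" "N (Suc j) = dim_row A" for j by (simp_all add: N_def)
    show ?thesis
      unfolding is_network_def True
    proof (intro conjI exI[of _ N] allI impI)
      fix j assume "j < length [(A, b)]"
      then have j: "j = 0" by simp
      show "fst ([(A, b)] ! j) \<in> carrier_mat (N (Suc j)) (N j)"
        "snd ([(A, b)] ! j) \<in> carrier_vec (N (Suc j))"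
        unfolding j N nth_Cons_0 fst_conv snd_conv by (rule *)+
    next
      fix j show "1 \<le> N j" using *(3,4) unfolding N_def by (cases "j = 0") simp_all
    qed simp
  next
    case False
    then obtain N where N: "\<And>j. j \<le> length \<Phi> \<Longrightarrow> N j \<ge> 1"
      "\<And>j. j < length \<Phi> \<Longrightarrow> fst (\<Phi> ! j) \<in> carrier_mat (N (Suc j)) (N j) \<and>
       snd (\<Phi> ! j) \<in> carrier_vec (N (Suc j))" and d: "d_in \<Phi> = dim_row A"
      using R unfolding is_network_def by blast
    have N0: "N 0 = dim_row A"
      using N(2)[of 0] d False by (auto simp: d_in_def hd_conv_nth)
    have R': "dim_row A \<ge> 1" "dim_col A \<ge> 1" "dim_vec b = dim_row A"
      using R by blast+
    define M where "M = (\<lambda>j. case j of 0 \<Rightarrow> dim_col A | Suc k \<Rightarrow> N k)"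
    have M: "M 0 = dim_col A" "M (Suc j) = N j" for j by (simp_all add: M_def)
    show ?thesis
      unfolding is_network_def
    proof (intro conjI exI[of _ M] allI impI)
      fix j assume j: "j < length ((A, b) # \<Phi>)"
      show "fst (((A, b) # \<Phi>) ! j) \<in> carrier_mat (M (Suc j)) (M j)"
      proof (cases j)
        case 0
        show ?thesis unfolding 0 M N0 by simp
      next
        case (Suc k)
        then have "k < length \<Phi>" using j by simp
        then show ?thesis unfolding Suc M nth_Cons_Suc using N(2)[of k] by simp
      qed
      show "snd (((A, b) # \<Phi>) ! j) \<in> carrier_vec (M (Suc j))"
      proof (cases j)
        case 0
        show ?thesis unfolding 0 M N0 nth_Cons_0 snd_conv using R'(3) by (rule carrier_vecI)
      next
        case (Suc k)
        then have "k < length \<Phi>" using j by simp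
        then show ?thesis unfolding Suc M nth_Cons_Suc using N(2)[of k] by simp
      qed
    next
      fix j assume "j \<le> length ((A, b) # \<Phi>)"
      then show "1 \<le> M j" using R'(2) N(1) by (cases j) (simp_all add: M)
    qed simp
  qed
qed

lemma abs_entry_le_max_mat:
  assumes "i < dim_row A" "j < dim_col A"
  shows "\<bar>A $$ (i, j)\<bar> \<le> max_mat A"
  unfolding max_mat_def using assms
  by (intro Max_ge imageI elements_matI[of A _ _ i j]) (auto simp: elements_mat_def)

lemma max_mat_le_nn_norm: "(A, b) \<in> set \<Phi> \<Longrightarrow> max_mat A \<le> nn_norm \<Phi>"
  unfolding nn_norm_def
  by (rule order_trans[OF max.cobounded1[of "max_mat A" "max_vec b"]])
     (rule Max_ge, auto intro: image_eqI[of _ _ "(A, b)"])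

lemma l0_mat_le_num_weights: "(A, b) \<in> set \<Phi> \<Longrightarrow> l0_mat A \<le> num_weights \<Phi>"
  unfolding num_weights_def
  by (rule order_trans[of _ "l0_mat A + l0_vec b"]) (auto intro!: member_le_sum_list)

text \<open>Only the non-zero entries contribute, and each is at most the largest one. An empty
  matrix, for which \<open>max_mat\<close> is unspecified, makes both sides zero.\<close>

lemma sum_abs_entries_le:
  "(\<Sum>i<dim_row A. \<Sum>j<dim_col A. \<bar>A $$ (i, j)\<bar>) \<le> max_mat A * real (l0_mat A)"
proof -
  let ?S = "{(i, j). i < dim_row A \<and> j < dim_col A \<and> A $$ (i, j) \<noteq> 0}"
  have "(\<Sum>i<dim_row A. \<Sum>j<dim_col A. \<bar>A $$ (i, j)\<bar>)
      = (\<Sum>ij\<in>{..<dim_row A} \<times> {..<dim_col A}. \<bar>A $$ ij\<bar>)"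
    by (simp add: sum.cartesian_product)
  also have "\<dots> = (\<Sum>ij\<in>?S. \<bar>A $$ ij\<bar>)"
    by (intro sum.mono_neutral_right) auto
  also have "\<dots> \<le> (\<Sum>ij\<in>?S. max_mat A)"
    by (intro sum_mono) (auto intro: abs_entry_le_max_mat)
  finally show ?thesis by (simp add: l0_mat_def mult.commute)
qed

lemma relu_lipschitz: "\<bar>relu x - relu y\<bar> \<le> \<bar>x - y\<bar>"
  by (auto simp: relu_def)

lemma affine_diff_le:
  fixes A :: "real mat"
  assumes "dim_vec x = dim_col A" "dim_vec y = dim_col A" "dim_vec b = dim_row A" "i < dim_row A"
  shows "\<bar>vec_index (A *\<^sub>v x + b) i - vec_index (A *\<^sub>v y + b) i\<bar>
       \<le> (\<Sum>j<dim_col A. \<bar>A $$ (i, j)\<bar> * \<bar>vec_index x j - vec_index y j\<bar>)"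
proof -
  have "vec_index (A *\<^sub>v x + b) i - vec_index (A *\<^sub>v y + b) i
      = (\<Sum>j<dim_col A. A $$ (i, j) * (vec_index x j - vec_index y j))"
    using assms by (simp add: scalar_prod_def atLeast0LessThan right_diff_distrib sum_subtractf)
  also have "\<bar>\<dots>\<bar> \<le> (\<Sum>j<dim_col A. \<bar>A $$ (i, j) * (vec_index x j - vec_index y j)\<bar>)"
    by (rule sum_abs)
  finally show ?thesis by (simp add: abs_mult)
qed

text \<open>The operator norm from l1 to linf is the largest absolute entry, so the number of
  weights does not enter.\<close>

lemma affine_l1_linf:
  assumes "dim_vec x = dim_col A" "dim_vec y = dim_col A" "dim_vec b = dim_row A" "i < dim_row A"
    and "max_mat A \<le> c"
  shows "\<bar>vec_index (A *\<^sub>v x + b) i - vec_index (A *\<^sub>v y + b) i\<bar>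
       \<le> c * (\<Sum>j<dim_col A. \<bar>vec_index x j - vec_index y j\<bar>)"
proof -
  have "(\<Sum>j<dim_col A. \<bar>A $$ (i, j)\<bar> * \<bar>vec_index x j - vec_index y j\<bar>)
      \<le> (\<Sum>j<dim_col A. c * \<bar>vec_index x j - vec_index y j\<bar>)"
    using assms abs_entry_le_max_mat[of i A]
    by (intro sum_mono mult_right_mono) (auto intro: order_trans)
  with affine_diff_le[OF assms(1-4)] show ?thesis by (simp add: sum_distrib_left)
qed

text \<open>The operator norm from linf to l1 is at most the sum of all absolute entries. Sparsity,
  not the matrix dimensions, controls this sum.\<close>

lemma affine_linf_l1:
  assumes "dim_vec x = dim_col A" "dim_vec y = dim_col A" "dim_vec b = dim_row A"
    and "max_mat A \<le> c" "l0_mat A \<le> n" "0 \<le> c" "0 \<le> B"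
    and B: "\<And>j. j < dim_col A \<Longrightarrow> \<bar>vec_index x j - vec_index y j\<bar> \<le> B"
  shows "(\<Sum>i<dim_row A. \<bar>vec_index (A *\<^sub>v x + b) i - vec_index (A *\<^sub>v y + b) i\<bar>) \<le> c * real n * B"
proof -
  have "(\<Sum>i<dim_row A. \<bar>vec_index (A *\<^sub>v x + b) i - vec_index (A *\<^sub>v y + b) i\<bar>)
     \<le> (\<Sum>i<dim_row A. \<Sum>j<dim_col A. \<bar>A $$ (i, j)\<bar> * B)"
    using assms by (intro sum_mono order_trans[OF affine_diff_le] mult_left_mono) auto
  also have "\<dots> = (\<Sum>i<dim_row A. \<Sum>j<dim_col A. \<bar>A $$ (i, j)\<bar>) * B"
    by (simp add: sum_distrib_right)
  also have "\<dots> \<le> (max_mat A * real (l0_mat A)) * B"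
    using sum_abs_entries_le \<open>0 \<le> B\<close> by (rule mult_right_mono)
  also have "\<dots> \<le> c * real n * B"
    using assms by (intro mult_right_mono mult_mono) auto
  finally show ?thesis .
qed

text \<open>
  Measuring the layers alternately in the norms \<open>\<ell>\<^sup>1\<close> and \<open>\<ell>\<^sup>\<infinity>\<close>, only the steps from \<open>\<ell>\<^sup>\<infinity>\<close> to
  \<open>\<ell>\<^sup>1\<close> cost a factor \<open>n\<close>.
\<close>

lemma realization_lipschitz:
  assumes "is_network \<Phi>" "\<And>A b. (A, b) \<in> set \<Phi> \<Longrightarrow> max_mat A \<le> c \<and> l0_mat A \<le> n" "0 \<le> c"
    and "dim_vec x = d_in \<Phi>" "dim_vec y = d_in \<Phi>" "i < d_out \<Phi>"
  shows "\<bar>vec_index (realization \<Phi> x) i - vec_index (realization \<Phi> y) i\<bar>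
           \<le> c ^ length \<Phi> * real n ^ (length \<Phi> div 2) *
             (\<Sum>j<d_in \<Phi>. \<bar>vec_index x j - vec_index y j\<bar>)"
    and "\<And>B. 0 \<le> B \<Longrightarrow> (\<And>j. j < d_in \<Phi> \<Longrightarrow> \<bar>vec_index x j - vec_index y j\<bar> \<le> B) \<Longrightarrow>
         \<bar>vec_index (realization \<Phi> x) i - vec_index (realization \<Phi> y) i\<bar>
           \<le> c ^ length \<Phi> * real n ^ (Suc (length \<Phi>) div 2) * B"
proof -
  \<comment> \<open>The two bounds need each other in the induction. Measuring the input in l1 leads
    to the linf bound of the tail with the same power of n; measuring it in linf leads to the l1
    bound of the tail with one more factor n.\<close>
  have "\<bar>vec_index (realization \<Phi> x) i - vec_index (realization \<Phi> y) i\<bar>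
           \<le> c ^ length \<Phi> * real n ^ (length \<Phi> div 2) *
             (\<Sum>j<d_in \<Phi>. \<bar>vec_index x j - vec_index y j\<bar>) \<and>
        (\<forall>B. 0 \<le> B \<longrightarrow> (\<forall>j < d_in \<Phi>. \<bar>vec_index x j - vec_index y j\<bar> \<le> B) \<longrightarrow>
         \<bar>vec_index (realization \<Phi> x) i - vec_index (realization \<Phi> y) i\<bar>
           \<le> c ^ length \<Phi> * real n ^ (Suc (length \<Phi>) div 2) * B)"
    using assms
  proof (induction \<Phi> x arbitrary: y rule: realization.induct)
    case (1 x)
    then show ?case by (simp add: is_network_def)
  next
    case (2 A b x)
    have dims: "dim_vec b = dim_row A" "dim_vec x = dim_col A" "dim_vec y = dim_col A" "i < dim_row A"
      using 2 by (auto simp: is_network_Cons_iff d_in_def d_out_def)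
    have c: "max_mat A \<le> c" "l0_mat A \<le> n" using 2 by auto
    show ?case
    proof (intro conjI allI impI)
      show "\<bar>vec_index (realization [(A, b)] x) i - vec_index (realization [(A, b)] y) i\<bar>
           \<le> c ^ length [(A, b)] * real n ^ (length [(A, b)] div 2) *
             (\<Sum>j<d_in [(A, b)]. \<bar>vec_index x j - vec_index y j\<bar>)"
        using affine_l1_linf[OF dims(2,3,1,4) c(1)] by (simp add: d_in_def)
    next
      fix B :: real
      assume B: "0 \<le> B" "\<forall>j<d_in [(A, b)]. \<bar>vec_index x j - vec_index y j\<bar> \<le> B"
      let ?f = "\<lambda>i. \<bar>vec_index (A *\<^sub>v x + b) i - vec_index (A *\<^sub>v y + b) i\<bar>"
      have "?f i \<le> (\<Sum>i<dim_row A. ?f i)"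
        by (rule member_le_sum) (use dims in auto)
      also have "\<dots> \<le> c * real n * B"
        by (rule affine_linf_l1) (use dims c B \<open>0 \<le> c\<close> in \<open>auto simp: d_in_def\<close>)
      finally show "\<bar>vec_index (realization [(A, b)] x) i - vec_index (realization [(A, b)] y) i\<bar>
          \<le> c ^ length [(A, b)] * real n ^ (Suc (length [(A, b)]) div 2) * B"
        by simp
    qed
  next
    case (3 A b l \<Phi> x)
    let ?\<Psi> = "l # \<Phi>"
    let ?x = "map_vec relu (A *\<^sub>v x + b)" and ?y = "map_vec relu (A *\<^sub>v y + b)"
    have dims: "dim_vec b = dim_row A" "dim_vec x = dim_col A" "dim_vec y = dim_col A" "i < d_out ?\<Psi>"
      and net: "is_network ?\<Psi>" "d_in ?\<Psi> = dim_row A"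
      using 3 by (auto simp: is_network_Cons_iff d_in_def d_out_def)
    have c: "max_mat A \<le> c" "l0_mat A \<le> n" using 3 by auto
    have IH: "\<bar>vec_index (realization ?\<Psi> ?x) i - vec_index (realization ?\<Psi> ?y) i\<bar>
           \<le> c ^ length ?\<Psi> * real n ^ (length ?\<Psi> div 2) *
             (\<Sum>j<d_in ?\<Psi>. \<bar>vec_index ?x j - vec_index ?y j\<bar>)"
        "\<And>B. 0 \<le> B \<Longrightarrow> (\<forall>j < d_in ?\<Psi>. \<bar>vec_index ?x j - vec_index ?y j\<bar> \<le> B) \<Longrightarrow>
         \<bar>vec_index (realization ?\<Psi> ?x) i - vec_index (realization ?\<Psi> ?y) i\<bar>
           \<le> c ^ length ?\<Psi> * real n ^ (Suc (length ?\<Psi>) div 2) * B"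
      using 3(1)[of ?y] net dims 3(3) \<open>0 \<le> c\<close> by auto
    have relu: "\<bar>vec_index ?x j - vec_index ?y j\<bar>
        \<le> \<bar>vec_index (A *\<^sub>v x + b) j - vec_index (A *\<^sub>v y + b) j\<bar>" if "j < dim_row A" for j
      using that dims by (simp add: relu_lipschitz del: index_add_vec(1) index_mult_mat_vec)
    have din: "d_in ((A, b) # ?\<Psi>) = dim_col A" by (simp add: d_in_def)
    show ?case
    proof (intro conjI allI impI)
      let ?B = "c * (\<Sum>j<dim_col A. \<bar>vec_index x j - vec_index y j\<bar>)"
      have "\<bar>vec_index (realization ?\<Psi> ?x) i - vec_index (realization ?\<Psi> ?y) i\<bar>
          \<le> c ^ length ?\<Psi> * real n ^ (Suc (length ?\<Psi>) div 2) * ?B"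
        using relu affine_l1_linf[OF dims(2,3,1) _ c(1)] \<open>0 \<le> c\<close>
        by (intro IH(2)) (auto simp: net sum_nonneg simp del: index_map_vec intro: order_trans)
      then show "\<bar>vec_index (realization ((A, b) # ?\<Psi>) x) i - vec_index (realization ((A, b) # ?\<Psi>) y) i\<bar>
           \<le> c ^ length ((A, b) # ?\<Psi>) * real n ^ (length ((A, b) # ?\<Psi>) div 2) *
             (\<Sum>j<d_in ((A, b) # ?\<Psi>). \<bar>vec_index x j - vec_index y j\<bar>)"
        by (simp add: din mult_ac)
    next
      fix B :: real
      assume B: "0 \<le> B" "\<forall>j<d_in ((A, b) # ?\<Psi>). \<bar>vec_index x j - vec_index y j\<bar> \<le> B"
      have "(\<Sum>j<d_in ?\<Psi>. \<bar>vec_index ?x j - vec_index ?y j\<bar>)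
          \<le> (\<Sum>j<dim_row A. \<bar>vec_index (A *\<^sub>v x + b) j - vec_index (A *\<^sub>v y + b) j\<bar>)"
        unfolding net(2) by (intro sum_mono relu) auto
      also have "\<dots> \<le> c * real n * B"
        by (rule affine_linf_l1) (use dims c B \<open>0 \<le> c\<close> in \<open>auto simp: din\<close>)
      finally have "c ^ length ?\<Psi> * real n ^ (length ?\<Psi> div 2) *
             (\<Sum>j<d_in ?\<Psi>. \<bar>vec_index ?x j - vec_index ?y j\<bar>)
          \<le> c ^ length ?\<Psi> * real n ^ (length ?\<Psi> div 2) * (c * real n * B)"
        using \<open>0 \<le> c\<close> by (intro mult_left_mono) auto
      with IH(1) show "\<bar>vec_index (realization ((A, b) # ?\<Psi>) x) i - vec_index (realization ((A, b) # ?\<Psi>) y) i\<bar>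
          \<le> c ^ length ((A, b) # ?\<Psi>) * real n ^ (Suc (length ((A, b) # ?\<Psi>)) div 2) * B"
        by (simp add: mult_ac)
    qed
  qed
  then show "\<bar>vec_index (realization \<Phi> x) i - vec_index (realization \<Phi> y) i\<bar>
           \<le> c ^ length \<Phi> * real n ^ (length \<Phi> div 2) *
             (\<Sum>j<d_in \<Phi>. \<bar>vec_index x j - vec_index y j\<bar>)"
    and "\<And>B. 0 \<le> B \<Longrightarrow> (\<And>j. j < d_in \<Phi> \<Longrightarrow> \<bar>vec_index x j - vec_index y j\<bar> \<le> B) \<Longrightarrow>
         \<bar>vec_index (realization \<Phi> x) i - vec_index (realization \<Phi> y) i\<bar>
           \<le> c ^ length \<Phi> * real n ^ (Suc (length \<Phi>) div 2) * B"
    by blast+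
qed

text \<open>The l1 distance of the inputs belongs to the sharper of the two bounds, the one with
  exponent \<open>L div 2\<close>. Passing to the Euclidean distance costs only a factor depending
  on d.\<close>

definition l1_lipschitz :: "real \<Rightarrow> (real ^ 'd \<Rightarrow> real) \<Rightarrow> bool" where
  "l1_lipschitz \<Lambda> g \<longleftrightarrow> (\<forall>x y. \<bar>g x - g y\<bar> \<le> \<Lambda> * (\<Sum>i\<in>UNIV. \<bar>vec_nth x i - vec_nth y i\<bar>))"

lemma sum_from_nat_into_UNIV:
  fixes f :: "'d::finite \<Rightarrow> 'b::comm_monoid_add"
  shows "(\<Sum>j<CARD('d). f (from_nat_into UNIV j)) = (\<Sum>i\<in>UNIV. f i)"
  using bij_betw_from_nat_into_finite[of "UNIV :: 'd set"]
  by (intro sum.reindex_bij_betw) auto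

text \<open>Each layer is charged with all n weights, as \<open>num_weights \<Phi>\<close> bounds
  every single \<open>l0_mat\<close>. The bound uses the actual depth L of the network because
  \<open>ell n\<close> may be infinite.\<close>

lemma nn_class_lipschitz:
  fixes g :: "real ^ 'd \<Rightarrow> real"
  assumes "g \<in> nn_class ell c n" "c n \<noteq> \<infinity>"
  obtains L where "enat L \<le> ell n" "l1_lipschitz (real (the_enat (c n)) ^ L * real n ^ (L div 2)) g"
proof -
  from assms obtain \<Phi> where g: "g = (\<lambda>x. vec_index (realization \<Phi> (input_vec x)) 0)"
    and \<Phi>: "is_network \<Phi>" "d_in \<Phi> = CARD('d)" "d_out \<Phi> = 1" "num_weights \<Phi> \<le> n"
      "enat (num_layers \<Phi>) \<le> ell n" "ennreal (nn_norm \<Phi>) \<le> ennreal_of_enat (c n)"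
    unfolding nn_class_def by blast
  obtain C where C: "c n = enat C" using assms(2) by auto
  have norm: "nn_norm \<Phi> \<le> real C"
    using \<Phi>(6) unfolding C ennreal_of_enat_enat ennreal_of_nat_eq_real_of_nat
    by (simp add: ennreal_le_iff)
  have "\<bar>g x - g y\<bar> \<le> real C ^ length \<Phi> * real n ^ (length \<Phi> div 2)
          * (\<Sum>i\<in>UNIV. \<bar>vec_nth x i - vec_nth y i\<bar>)" for x y
  proof -
    have "\<bar>g x - g y\<bar> \<le> real C ^ length \<Phi> * real n ^ (length \<Phi> div 2)
          * (\<Sum>j<d_in \<Phi>. \<bar>vec_index (input_vec x) j - vec_index (input_vec y) j\<bar>)"
      unfolding g
    proof (rule realization_lipschitz(1))
      show "max_mat A \<le> real C \<and> l0_mat A \<le> n" if "(A, b) \<in> set \<Phi>" for A b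
        using max_mat_le_nn_norm[OF that] l0_mat_le_num_weights[OF that] norm \<Phi>(4) by auto
    qed (use \<Phi> in \<open>auto simp: input_vec_def\<close>)
    also have "(\<Sum>j<d_in \<Phi>. \<bar>vec_index (input_vec x) j - vec_index (input_vec y) j\<bar>)
        = (\<Sum>j<CARD('d). \<bar>vec_nth x (from_nat_into UNIV j) - vec_nth y (from_nat_into UNIV j)\<bar>)"
      by (simp add: \<Phi>(2) input_vec_def)
    finally show ?thesis by (simp add: sum_from_nat_into_UNIV[of "\<lambda>i. \<bar>vec_nth x i - vec_nth y i\<bar>"])
  qed
  then have "l1_lipschitz (real (the_enat (c n)) ^ length \<Phi> * real n ^ (length \<Phi> div 2)) g"
    unfolding l1_lipschitz_def C the_enat.simps by blast
  with \<Phi>(5) show ?thesis unfolding num_layers_def by (rule that)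
qed

section \<open>Lebesgue norms on the unit cube\<close>

text \<open>Bounds on the norm become bounds on the integral of the q-th power. This removes the
  case of an infinite integral and works alike for q below and above 1.\<close>

lemma Lp_norm_le_iff:
  assumes "0 < q" "0 \<le> a"
  shows "Lp_norm M (ennreal q) f \<le> ennreal a \<longleftrightarrow>
         (\<integral>\<^sup>+ x. ennreal (\<bar>f x\<bar> powr q) \<partial>M) \<le> ennreal (a powr q)"
proof -
  define I where "I = (\<integral>\<^sup>+ x. ennreal (\<bar>f x\<bar> powr q) \<partial>M)"
  have Lp: "Lp_norm M (ennreal q) f = (if I = \<infinity> then \<infinity> else ennreal (enn2real I powr (1 / q)))"
    using assms by (simp add: Lp_norm_def I_def Let_def)
  show ?thesis
  proof (cases I)
    case (real i)
    have "i powr (1 / q) \<le> a \<longleftrightarrow> i \<le> a powr q"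
    proof
      assume "i powr (1 / q) \<le> a"
      then have "(i powr (1 / q)) powr q \<le> a powr q" using assms by (intro powr_mono2) auto
      then show "i \<le> a powr q" using assms real by (simp add: powr_powr)
    next
      assume "i \<le> a powr q"
      then have "i powr (1 / q) \<le> (a powr q) powr (1 / q)" using assms real by (intro powr_mono2) auto
      then show "i powr (1 / q) \<le> a" using assms by (simp add: powr_powr)
    qed
    then show ?thesis using real assms by (simp add: Lp flip: I_def)
  next
    case top
    then show ?thesis by (simp add: Lp top_unique flip: I_def)
  qed
qed

lemma Lp_norm_infinity_le_iff:
  assumes "f \<in> borel_measurable M" "0 \<le> a"
  shows "Lp_norm M \<infinity> f \<le> ennreal a \<longleftrightarrow> (AE x in M. \<bar>f x\<bar> \<le> a)"
proof -
  have [measurable]: "(\<lambda>x. ennreal \<bar>f x\<bar>) \<in> borel_measurable M" using assms by simp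
  have "esssup M (\<lambda>x. ennreal \<bar>f x\<bar>) \<le> ennreal a \<longleftrightarrow> (AE x in M. ennreal \<bar>f x\<bar> \<le> ennreal a)"
  proof
    assume "esssup M (\<lambda>x. ennreal \<bar>f x\<bar>) \<le> ennreal a"
    with esssup_AE[of "\<lambda>x. ennreal \<bar>f x\<bar>" M] show "AE x in M. ennreal \<bar>f x\<bar> \<le> ennreal a"
      by (auto elim!: eventually_mono intro: order_trans)
  qed (rule esssup_I; measurable)
  then show ?thesis using assms by (simp add: Lp_norm_def ennreal_le_iff)
qed

lemma ennreal_pos_cases:
  assumes "(p :: ennreal) > 0"
  obtains "p = \<infinity>" | q where "q > 0" "p = ennreal q"
  using assms by (cases p) (auto simp: ennreal_less_zero_iff)

lemma Lp_norm_quasi_triangle: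
  assumes "p > 0"
  obtains Q :: real where "Q > 0"
    "\<And>f g a. \<lbrakk>f \<in> borel_measurable M; g \<in> borel_measurable M; 0 \<le> a; Lp_norm M p f \<le> ennreal a;
        Lp_norm M p g \<le> ennreal a\<rbrakk> \<Longrightarrow> Lp_norm M p (\<lambda>x. f x - g x) \<le> ennreal (Q * a)"
  using assms
proof (cases rule: ennreal_pos_cases)
  case 1
  show ?thesis
  proof (rule that[of 2])
    fix f g a
    assume m[measurable]: "f \<in> borel_measurable M" "g \<in> borel_measurable M"
      and a: "0 \<le> (a :: real)"
      and le: "Lp_norm M p f \<le> ennreal a" "Lp_norm M p g \<le> ennreal a"
    have "AE x in M. \<bar>f x\<bar> \<le> a" "AE x in M. \<bar>g x\<bar> \<le> a"
      using le unfolding 1 Lp_norm_infinity_le_iff[OF m(1) a] Lp_norm_infinity_le_iff[OF m(2) a] .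
    then have "AE x in M. \<bar>f x - g x\<bar> \<le> 2 * a" by eventually_elim auto
    then show "Lp_norm M p (\<lambda>x. f x - g x) \<le> ennreal (2 * a)"
      unfolding 1 using a by (subst Lp_norm_infinity_le_iff) auto
  qed auto
next
  case (2 q)
  show ?thesis
  proof (rule that[of "2 * 2 powr (1 / q)"])
    fix f g a
    assume m[measurable]: "f \<in> borel_measurable M" "g \<in> borel_measurable M"
      and a: "0 \<le> (a :: real)"
      and le: "Lp_norm M p f \<le> ennreal a" "Lp_norm M p g \<le> ennreal a"
    have pw: "\<bar>u - v\<bar> powr q \<le> 2 powr q * (\<bar>u\<bar> powr q + \<bar>v\<bar> powr q)" for u v :: real
    proof -
      have "\<bar>u - v\<bar> powr q \<le> (2 * max \<bar>u\<bar> \<bar>v\<bar>) powr q" using 2 by (intro powr_mono2) auto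
      also have "\<dots> = 2 powr q * max \<bar>u\<bar> \<bar>v\<bar> powr q" by (simp add: powr_mult)
      also have "\<dots> \<le> 2 powr q * (\<bar>u\<bar> powr q + \<bar>v\<bar> powr q)"
        by (intro mult_left_mono) (auto simp: max_def)
      finally show ?thesis .
    qed
    have le': "(\<integral>\<^sup>+ x. ennreal (\<bar>f x\<bar> powr q) \<partial>M) \<le> ennreal (a powr q)"
      "(\<integral>\<^sup>+ x. ennreal (\<bar>g x\<bar> powr q) \<partial>M) \<le> ennreal (a powr q)"
      using le 2 a by (simp_all add: Lp_norm_le_iff)
    have "(\<integral>\<^sup>+ x. ennreal (\<bar>f x - g x\<bar> powr q) \<partial>M)
        \<le> (\<integral>\<^sup>+ x. ennreal (2 powr q) * (ennreal (\<bar>f x\<bar> powr q) + ennreal (\<bar>g x\<bar> powr q)) \<partial>M)"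
      using pw by (intro nn_integral_mono) (simp flip: ennreal_plus ennreal_mult)
    also have "\<dots> = ennreal (2 powr q) * ((\<integral>\<^sup>+ x. ennreal (\<bar>f x\<bar> powr q) \<partial>M) + (\<integral>\<^sup>+ x. ennreal (\<bar>g x\<bar> powr q) \<partial>M))"
      by (simp add: nn_integral_cmult nn_integral_add)
    also have "\<dots> \<le> ennreal (2 powr q) * (ennreal (a powr q) + ennreal (a powr q))"
      by (intro mult_left_mono add_mono le') auto
    also have "\<dots> = ennreal (2 powr q * (2 * a powr q))"
      by (simp flip: ennreal_plus ennreal_mult)
    also have "2 powr q * (2 * a powr q) = (2 * 2 powr (1 / q) * a) powr q"
      using 2 a by (simp add: powr_mult powr_powr)
    finally show "Lp_norm M p (\<lambda>x. f x - g x) \<le> ennreal (2 * 2 powr (1 / q) * a)"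
      using 2 a by (simp add: Lp_norm_le_iff)
  qed auto
qed

lemma Lp_norm_0_AE:
  assumes "p > 0" "f \<in> borel_measurable M" "Lp_norm M p f \<le> 0"
  shows "AE x in M. f x = 0"
  using assms(1)
proof (cases rule: ennreal_pos_cases)
  case 1
  have "AE x in M. \<bar>f x\<bar> \<le> 0"
    using assms(3) unfolding 1 Lp_norm_infinity_le_iff[OF assms(2) order_refl, unfolded ennreal_0] .
  then show ?thesis by simp
next
  case (2 q)
  have "(\<integral>\<^sup>+ x. ennreal (\<bar>f x\<bar> powr q) \<partial>M) = 0"
    using Lp_norm_le_iff[of q 0 M f] assms(3) 2 by simp
  then have "AE x in M. ennreal (\<bar>f x\<bar> powr q) = 0"
    using assms(2) by (subst (asm) nn_integral_0_iff_AE) auto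
  then show ?thesis by (auto simp: ennreal_eq_0_iff elim!: eventually_mono)
qed

lemma emeasure_lebesgue_on_unit_cube:
  fixes u :: "real ^ 'd"
  assumes "0 \<le> r" and sub: "cbox u (\<chi> i. vec_nth u i + r) \<subseteq> unit_cube"
  shows "emeasure (lebesgue_on unit_cube) (cbox u (\<chi> i. vec_nth u i + r)) = ennreal (r ^ CARD('d))"
proof -
  let ?B = "cbox u (\<chi> i. vec_nth u i + r)"
  have "u \<in> ?B" using assms by (simp add: mem_box_cart)
  then have "measure lborel ?B = r ^ CARD('d)" by (subst content_cbox_cart) auto
  moreover have "emeasure lborel ?B = ennreal (measure lborel ?B)"
    by (intro emeasure_eq_ennreal_measure) (auto simp: emeasure_lborel_cbox_eq)
  ultimately have "emeasure lebesgue ?B = ennreal (r ^ CARD('d))"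
    by (simp add: emeasure_completion)
  then show ?thesis
    using sub by (subst emeasure_restrict_space) auto
qed

text \<open>The cube has measure one, so no constant appears for any p.\<close>

lemma Lp_cube_norm_le_sup:
  fixes g :: "real ^ 'd \<Rightarrow> real"
  assumes "p > 0" "g \<in> borel_measurable (lebesgue_on unit_cube)" "0 \<le> a"
    and le: "\<And>x. x \<in> unit_cube \<Longrightarrow> \<bar>g x\<bar> \<le> a"
  shows "Lp_cube_norm p g \<le> ennreal a"
  using assms(1)
proof (cases rule: ennreal_pos_cases)
  case 1
  show ?thesis
    unfolding 1 Lp_norm_infinity_le_iff[OF assms(2,3)]
    using le by (intro AE_I2) (simp add: space_restrict_space)
next
  case (2 q)
  have one: "(\<chi> i. vec_nth (0 :: real ^ 'd) i + 1) = 1" by (simp add: one_vec_def)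
  have "(\<integral>\<^sup>+ x. ennreal (\<bar>g x\<bar> powr q) \<partial>lebesgue_on unit_cube)
      \<le> (\<integral>\<^sup>+ x. ennreal (a powr q) \<partial>lebesgue_on (unit_cube :: (real ^ 'd) set))"
    using le 2 by (intro nn_integral_mono ennreal_leI powr_mono2) (auto simp: space_restrict_space)
  also have "\<dots> = ennreal (a powr q)"
    using emeasure_lebesgue_on_unit_cube[of 1 "0 :: real ^ 'd"]
    unfolding one by (simp add: space_restrict_space)
  finally show ?thesis using 2 assms(3) by (simp add: Lp_norm_le_iff)
qed

section \<open>Small boxes in the cube and almost-everywhere statements\<close>

lemma unit_cube_subbox:
  fixes x :: "real ^ 'd"
  assumes "x \<in> unit_cube" "0 < r" "r \<le> 1"
  obtains B where "B \<subseteq> unit_cube" "B \<in> sets (lebesgue_on unit_cube)"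
    "emeasure (lebesgue_on unit_cube) B = ennreal (r ^ CARD('d))"
    "\<And>y i. y \<in> B \<Longrightarrow> \<bar>vec_nth y i - vec_nth x i\<bar> \<le> r"
proof -
  \<comment> \<open>Clamping the lower corner at 1 - r keeps the box inside the cube also near its
    boundary, while x still lies in the box.\<close>
  define u where "u = (\<chi> i. min (vec_nth x i) (1 - r))"
  define B where "B = cbox u (\<chi> i. vec_nth u i + r)"
  have x: "0 \<le> vec_nth x i" "vec_nth x i \<le> 1" for i using assms(1) by (auto simp: mem_box_cart)
  have sub: "B \<subseteq> unit_cube"
  proof
    fix y assume "y \<in> B"
    then have y: "min (vec_nth x i) (1 - r) \<le> vec_nth y i" "vec_nth y i \<le> min (vec_nth x i) (1 - r) + r" for i
      by (auto simp: B_def u_def mem_box_cart)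
    show "y \<in> unit_cube"
      unfolding mem_box_cart
    proof (intro allI conjI)
      fix i show "vec_nth 0 i \<le> vec_nth y i" "vec_nth y i \<le> vec_nth 1 i"
        using x[of i] y[of i] assms(2,3) by (auto simp: min_def split: if_splits)
    qed
  qed
  have near: "\<bar>vec_nth y i - vec_nth x i\<bar> \<le> r" if "y \<in> B" for y i
  proof -
    have y: "min (vec_nth x i) (1 - r) \<le> vec_nth y i" "vec_nth y i \<le> min (vec_nth x i) (1 - r) + r"
      using that by (auto simp: B_def u_def mem_box_cart)
    show ?thesis using y x[of i] assms(2,3) by (auto simp: min_def split: if_splits)
  qed
  have em: "emeasure (lebesgue_on unit_cube) B = ennreal (r ^ CARD('d))"
    unfolding B_def using assms sub by (intro emeasure_lebesgue_on_unit_cube) (auto simp: B_def)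
  have "B \<in> sets (lebesgue_on unit_cube)"
    using sub by (subst sets_restrict_space_iff) (auto simp: B_def)
  from that[OF sub this em near] show ?thesis .
qed

text \<open>The subbox at x has positive measure, so it cannot lie in the exceptional null set.
  Points x on the boundary of the cube are included.\<close>

lemma AE_unit_cube_near:
  fixes x :: "real ^ 'd"
  assumes "AE y in lebesgue_on unit_cube. P y" "x \<in> unit_cube" "0 < r" "r \<le> 1"
  obtains y where "y \<in> unit_cube" "\<And>i. \<bar>vec_nth y i - vec_nth x i\<bar> \<le> r" "P y"
proof -
  obtain B :: "(real ^ 'd) set" where B: "B \<subseteq> unit_cube" "B \<in> sets (lebesgue_on unit_cube)"
    "emeasure (lebesgue_on unit_cube) B = ennreal (r ^ CARD('d))"
    "\<And>y i. y \<in> B \<Longrightarrow> \<bar>vec_nth y i - vec_nth x i\<bar> \<le> r"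
    by (rule unit_cube_subbox[OF assms(2-4)]) blast
  have "\<exists>y\<in>B. P y"
  proof (rule ccontr)
    assume "\<not> (\<exists>y\<in>B. P y)"
    then have "AE y in lebesgue_on unit_cube. y \<notin> B"
      using assms(1) by (auto elim!: eventually_mono)
    then have "B \<in> null_sets (lebesgue_on unit_cube)"
      using B(2) by (simp add: AE_iff_null_sets)
    then have "r ^ CARD('d) \<le> 0" using B(3) by (auto simp: null_sets_def ennreal_eq_0_iff)
    then show False using zero_less_power[OF assms(3), of "CARD('d)"] by linarith
  qed
  then show ?thesis using that B by blast
qed

text \<open>If h x were outside C, then so would be h on a whole small box at x. With C = {0} this
  yields uniqueness of continuous versions; with C a ball it turns essential bounds into pointwise
  ones.\<close>

lemma AE_unit_cube_continuous_closed:
  fixes h :: "real ^ 'd \<Rightarrow> real"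
  assumes "continuous_on unit_cube h" "closed C" "AE y in lebesgue_on unit_cube. h y \<in> C"
    and x: "x \<in> unit_cube"
  shows "h x \<in> C"
proof (rule ccontr)
  assume "h x \<notin> C"
  then have "h x \<in> - C" "open (- C)" using assms(2) by auto
  then obtain e where e: "e > 0" "ball (h x) e \<subseteq> - C" by (meson openE)
  then obtain \<delta> where \<delta>: "\<delta> > 0" "\<And>y. y \<in> unit_cube \<Longrightarrow> dist y x < \<delta> \<Longrightarrow> dist (h y) (h x) < e"
    using assms(1) x unfolding continuous_on_iff by metis
  \<comment> \<open>Distances to x in the box are at most d * r; the factor 2 makes the comparison
    with \<delta> strict.\<close>
  define r where "r = min 1 (\<delta> / (2 * CARD('d)))"
  have r: "0 < r" "r \<le> 1" "real CARD('d) * r < \<delta>"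
    using \<delta>(1) by (auto simp: r_def min_def field_simps)
  obtain y where y: "y \<in> unit_cube" "\<And>i. \<bar>vec_nth y i - vec_nth x i\<bar> \<le> r" "h y \<in> C"
    using AE_unit_cube_near[OF assms(3) x r(1,2)] by blast
  have "dist y x \<le> (\<Sum>i\<in>UNIV. \<bar>vec_nth (y - x) i\<bar>)" unfolding dist_norm by (rule norm_le_l1_cart)
  also have "\<dots> \<le> (\<Sum>i\<in>(UNIV :: 'd set). r)" using y(2) by (intro sum_mono) auto
  also have "\<dots> < \<delta>" using r(3) by simp
  finally have "dist (h y) (h x) < e" using \<delta>(2) y(1) by blast
  then have "h y \<in> ball (h x) e" by (simp add: dist_commute)
  with e(2) have "h y \<in> - C" by blast
  with y(3) show False by blast
qed

lemma AE_unit_cube_continuous_eq: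
  fixes f g :: "real ^ 'd \<Rightarrow> real"
  assumes "continuous_on unit_cube f" "continuous_on unit_cube g"
    and "AE y in lebesgue_on unit_cube. f y = g y" "x \<in> unit_cube"
  shows "f x = g x"
  using AE_unit_cube_continuous_closed[of "\<lambda>x. f x - g x" "{0}" x] assms
  by (auto intro: continuous_on_diff)

section \<open>Lipschitz functions: pointwise bounds from L^p bounds\<close>

lemma l1_lipschitzD:
  "l1_lipschitz \<Lambda> g \<Longrightarrow> \<bar>g x - g y\<bar> \<le> \<Lambda> * (\<Sum>i\<in>UNIV. \<bar>vec_nth x i - vec_nth y i\<bar>)"
  by (simp add: l1_lipschitz_def)

lemma l1_lipschitz_diff:
  fixes g :: "real ^ 'd \<Rightarrow> real"
  assumes "l1_lipschitz \<Lambda> g" "l1_lipschitz \<Lambda>' h"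
  shows "l1_lipschitz (\<Lambda> + \<Lambda>') (\<lambda>x. g x - h x)"
  unfolding l1_lipschitz_def
proof (intro allI)
  fix x y :: "real ^ 'd"
  show "\<bar>g x - h x - (g y - h y)\<bar> \<le> (\<Lambda> + \<Lambda>') * (\<Sum>i\<in>UNIV. \<bar>vec_nth x i - vec_nth y i\<bar>)"
    using l1_lipschitzD[OF assms(1), of x y] l1_lipschitzD[OF assms(2), of x y]
    by (simp add: distrib_right)
qed

lemma l1_lipschitz_mono:
  fixes g :: "real ^ 'd \<Rightarrow> real"
  assumes "l1_lipschitz \<Lambda> g" "\<Lambda> \<le> \<Lambda>'"
  shows "l1_lipschitz \<Lambda>' g"
  unfolding l1_lipschitz_def
proof (intro allI)
  fix x y :: "real ^ 'd"
  have "\<Lambda> * (\<Sum>i\<in>UNIV. \<bar>vec_nth x i - vec_nth y i\<bar>) \<le> \<Lambda>' * (\<Sum>i\<in>UNIV. \<bar>vec_nth x i - vec_nth y i\<bar>)"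
    using assms(2) by (intro mult_right_mono sum_nonneg) auto
  with l1_lipschitzD[OF assms(1), of x y]
  show "\<bar>g x - g y\<bar> \<le> \<Lambda>' * (\<Sum>i\<in>UNIV. \<bar>vec_nth x i - vec_nth y i\<bar>)"
    by (rule order_trans)
qed

lemma l1_lipschitz_continuous:
  fixes g :: "real ^ 'd \<Rightarrow> real"
  assumes "l1_lipschitz \<Lambda> g"
  shows "continuous_on S g"
proof -
  let ?\<Lambda> = "\<bar>\<Lambda>\<bar>"
  have "(?\<Lambda> * real CARD('d))-lipschitz_on S g"
  proof (rule lipschitz_onI)
    fix x y
    have "dist (g x) (g y) \<le> ?\<Lambda> * (\<Sum>i\<in>UNIV. \<bar>vec_nth x i - vec_nth y i\<bar>)"
      using l1_lipschitzD[OF l1_lipschitz_mono[OF assms], of ?\<Lambda>] by (simp add: dist_real_def)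
    also have "\<dots> \<le> ?\<Lambda> * (\<Sum>i\<in>(UNIV :: 'd set). dist x y)"
      using component_le_norm_cart[of "x - y"] by (intro mult_left_mono sum_mono) (auto simp: dist_norm)
    finally show "dist (g x) (g y) \<le> ?\<Lambda> * real CARD('d) * dist x y" by (simp add: mult.assoc)
  qed simp
  then show ?thesis by (rule lipschitz_on_continuous_on)
qed

lemma continuous_measurable_unit_cube:
  fixes g :: "real ^ 'd \<Rightarrow> real"
  shows "continuous_on unit_cube g \<Longrightarrow> g \<in> borel_measurable (lebesgue_on unit_cube)"
  by (rule continuous_imp_measurable_on_sets_lebesgue) auto

lemma abs_le_by_Lp_norm_infinity:
  fixes g :: "real ^ 'd \<Rightarrow> real"
  assumes "continuous_on unit_cube g" "Lp_cube_norm \<infinity> g \<le> ennreal \<delta>" "0 \<le> \<delta>" "x \<in> unit_cube"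
  shows "\<bar>g x\<bar> \<le> \<delta>"
proof -
  have "AE y in lebesgue_on unit_cube. \<bar>g y\<bar> \<le> \<delta>"
    using assms(2) unfolding
      Lp_norm_infinity_le_iff[OF continuous_measurable_unit_cube[OF assms(1)] assms(3)] .
  then have "AE y in lebesgue_on unit_cube. g y \<in> cball 0 \<delta>" by simp
  from AE_unit_cube_continuous_closed[OF assms(1) closed_cball this assms(4)]
  show ?thesis by simp
qed

text \<open>
  The value at \<open>x\<close> is at most the minimum of \<open>\<bar>g\<bar>\<close> over a box of side \<open>r\<close> near \<open>x\<close>, up to the
  oscillation of \<open>g\<close> on that box.
\<close>

lemma abs_le_by_Lp_norm:
  fixes g :: "real ^ 'd \<Rightarrow> real"
  assumes lip: "l1_lipschitz \<Lambda> g" and "0 \<le> \<Lambda>" and q: "0 < q" and le: "Lp_cube_norm (ennreal q) g \<le> ennreal \<delta>"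
    and "0 \<le> \<delta>" and x: "x \<in> unit_cube" and r: "0 < r" "r \<le> 1"
  shows "\<bar>g x\<bar> \<le> \<Lambda> * (real CARD('d) * r) + r powr (- real CARD('d) / q) * \<delta>"
proof -
  define m where "m = \<bar>g x\<bar> - \<Lambda> * (real CARD('d) * r)"
  show ?thesis
  \<comment> \<open>\<open>m\<close> bounds |g| from below on the box. If it is not positive, the
    oscillation term alone already dominates |g x|.\<close>
  proof (cases "m \<le> 0")
    case True
    moreover have "0 \<le> r powr (- real CARD('d) / q) * \<delta>" using \<open>0 \<le> \<delta>\<close> by simp
    ultimately show ?thesis unfolding m_def by linarith
  next
    case False
    obtain B :: "(real ^ 'd) set" where B: "B \<subseteq> unit_cube" "B \<in> sets (lebesgue_on unit_cube)"
      "emeasure (lebesgue_on unit_cube) B = ennreal (r ^ CARD('d))"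
      "\<And>y i. y \<in> B \<Longrightarrow> \<bar>vec_nth y i - vec_nth x i\<bar> \<le> r"
      by (rule unit_cube_subbox[OF x r]) blast
    have m: "m \<le> \<bar>g y\<bar>" if "y \<in> B" for y
    proof -
      have "\<bar>g y - g x\<bar> \<le> \<Lambda> * (\<Sum>i\<in>UNIV. \<bar>vec_nth y i - vec_nth x i\<bar>)"
        using lip by (rule l1_lipschitzD)
      also have "\<dots> \<le> \<Lambda> * (\<Sum>i\<in>(UNIV :: 'd set). r)"
        using B(4)[OF that] \<open>0 \<le> \<Lambda>\<close> by (intro mult_left_mono sum_mono) auto
      finally show ?thesis unfolding m_def by simp
    qed
    \<comment> \<open>Chebyshev's inequality on the box: m powr q times its volume is at most the
      integral. Taking q-th roots produces the second term of the claim.\<close>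
    have "ennreal (m powr q * r ^ CARD('d)) = (\<integral>\<^sup>+ y. ennreal (m powr q) * indicator B y \<partial>lebesgue_on unit_cube)"
      using B(2,3) r by (simp add: nn_integral_cmult_indicator ennreal_mult)
    also have "\<dots> \<le> (\<integral>\<^sup>+ y. ennreal (\<bar>g y\<bar> powr q) \<partial>lebesgue_on unit_cube)"
      using m False q by (intro nn_integral_mono) (auto simp: indicator_def intro!: powr_mono2)
    also have "\<dots> \<le> ennreal (\<delta> powr q)"
      using le q \<open>0 \<le> \<delta>\<close> by (simp add: Lp_norm_le_iff)
    finally have "m powr q * r ^ CARD('d) \<le> \<delta> powr q" by (simp add: ennreal_le_iff)
    then have "r powr (- real CARD('d)) * (m powr q * r ^ CARD('d)) \<le> r powr (- real CARD('d)) * \<delta> powr q"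
      by (rule mult_left_mono) simp
    moreover have "r powr (- real CARD('d)) * r ^ CARD('d) = 1"
      using r by (simp add: powr_minus powr_realpow)
    ultimately have "m powr q \<le> r powr (- real CARD('d)) * \<delta> powr q"
      by (simp add: mult.left_commute[of _ "m powr q"])
    then have "(m powr q) powr (1 / q) \<le> (r powr (- real CARD('d)) * \<delta> powr q) powr (1 / q)"
      using q by (intro powr_mono2) auto
    then have "m \<le> r powr (- real CARD('d) / q) * \<delta>"
      using False q \<open>0 \<le> \<delta>\<close> by (simp add: powr_powr powr_mult)
    then show ?thesis unfolding m_def by linarith
  qed
qed

section \<open>Networks realizing spikes\<close>

text \<open>Layers with one repeated weight suffice for the lower bound: such a layer sees only the
  sum of its inputs, so values are available in closed form.\<close>

definition const_layer :: "nat \<Rightarrow> nat \<Rightarrow> real \<Rightarrow> real \<Rightarrow> real mat \<times> real vec" where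
  "const_layer r s a b = (Matrix.mat r s (\<lambda>_. a), Matrix.vec r (\<lambda>_. b))"

text \<open>Multiplies a non-negative number by c ^ k * m ^ (k div 2) when preceded by a layer with
  one output. Two layers 1 -> m -> 1 make m copies and add them up, gaining c ^ 2 * m with at most 2
  * m weights; a leftover layer gains only c. This realizes the worst case of the alternating norm
  estimate.\<close>

fun amplifier :: "nat \<Rightarrow> real \<Rightarrow> nat \<Rightarrow> network" where
  "amplifier m c 0 = []"
| "amplifier m c (Suc 0) = [const_layer 1 1 c 0]"
| "amplifier m c (Suc (Suc k)) = const_layer m 1 c 0 # const_layer 1 m c 0 # amplifier m c k"

text \<open>The m copies are already made by the first layer, so the depth is k + 2 and the slope is
  c ^ (k + 2) * m ^ ((k + 2) div 2) in absolute value: the Lipschitz bound with m in place of n.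
  Only the first layer has a bias, which sets the width of the spike.\<close>

definition spike_network :: "nat \<Rightarrow> nat \<Rightarrow> real \<Rightarrow> real \<Rightarrow> nat \<Rightarrow> network" where
  "spike_network d m c \<beta> k = const_layer m d (- c) \<beta> # const_layer 1 m c 0 # amplifier m c k"

lemma is_network_const_layer_Cons:
  "is_network (const_layer r s a b # \<Phi>) \<longleftrightarrow>
     r \<ge> 1 \<and> s \<ge> 1 \<and> (\<Phi> = [] \<or> is_network \<Phi> \<and> d_in \<Phi> = r)"
  unfolding const_layer_def is_network_Cons_iff dim_row_mat dim_col_mat dim_vec by simp

lemma d_in_const_layer_Cons: "d_in (const_layer r s a b # \<Phi>) = s"
  by (simp add: d_in_def const_layer_def)

lemma affine_const_layer:
  assumes "dim_vec x = s"
  shows "Matrix.mat r s (\<lambda>_. a) *\<^sub>v x + Matrix.vec r (\<lambda>_. b)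
       = Matrix.vec r (\<lambda>_. a * (\<Sum>j<s. vec_index x j) + (b :: real))"
  using assms by (intro eq_vecI) (simp_all add: scalar_prod_def atLeast0LessThan sum_distrib_left)

text \<open>All values passed on are non-negative, so \<open>relu\<close> acts as the identity. The
  layer in front is kept general because after one pair of layers \<open>const_layer 1 m c 0\<close>
  takes its place in the induction. For k = 0 it is the last layer and has no activation behind
  it.\<close>

lemma realization_const_layer_amplifier:
  assumes "dim_vec x = s" "0 \<le> c" "0 \<le> a * (\<Sum>j<s. vec_index x j) + b"
  shows "realization (const_layer 1 s a b # amplifier m c k) x
       = Matrix.vec 1 (\<lambda>_. c ^ k * real m ^ (k div 2) * (a * (\<Sum>j<s. vec_index x j) + b))"
  using assms
proof (induction m c k arbitrary: s a b x rule: amplifier.induct)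
  case (1 m c)
  then show ?case by (simp add: const_layer_def affine_const_layer)
next
  case (2 m c)
  let ?y = "a * (\<Sum>j<s. vec_index x j) + b"
  have "map_vec relu (Matrix.vec 1 (\<lambda>_. ?y)) = Matrix.vec 1 (\<lambda>_. ?y)"
    using 2 by (intro eq_vecI) (simp_all add: relu_def)
  then show ?case using 2
    by (simp add: const_layer_def affine_const_layer)
next
  case (3 m c k)
  let ?y = "a * (\<Sum>j<s. vec_index x j) + b"
  let ?x = "Matrix.vec m (\<lambda>_. c * ?y)"
  have relu1: "map_vec relu (Matrix.vec 1 (\<lambda>_. ?y)) = Matrix.vec 1 (\<lambda>_. ?y)"
    using 3 by (intro eq_vecI) (simp_all add: relu_def)
  have relu2: "map_vec relu ?x = ?x"
    using 3 by (intro eq_vecI) (simp_all add: relu_def)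
  have sum: "(\<Sum>j<m. vec_index ?x j) = real m * (c * ?y)" by simp
  have "realization (const_layer 1 s a b # amplifier m c (Suc (Suc k))) x
      = realization (const_layer 1 m c 0 # amplifier m c k) ?x"
    using relu2
    by (simp add: const_layer_def affine_const_layer[OF \<open>dim_vec x = s\<close>] relu1[unfolded One_nat_def])
       (simp add: affine_const_layer)
  also have "\<dots> = Matrix.vec 1 (\<lambda>_. c ^ k * real m ^ (k div 2) * (c * (\<Sum>j<m. vec_index ?x j) + 0))"
  proof (rule "3.IH")
    show "0 \<le> c * (\<Sum>j<m. vec_index ?x j) + 0" unfolding sum using 3 by simp
  qed (use 3 in simp_all)
  also have "\<dots> = Matrix.vec 1 (\<lambda>_. c ^ Suc (Suc k) * real m ^ (Suc (Suc k) div 2) * ?y)"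
    unfolding sum by (simp add: mult_ac)
  finally show ?case .
qed

lemma realization_spike_network:
  assumes "dim_vec x = d" "0 \<le> c"
  shows "realization (spike_network d m c \<beta> k) x
       = Matrix.vec 1 (\<lambda>_. c ^ Suc k * real m ^ (Suc (Suc k) div 2) *
           relu (\<beta> - c * (\<Sum>j<d. vec_index x j)))"
proof -
  let ?y = "relu (\<beta> - c * (\<Sum>j<d. vec_index x j))"
  let ?x = "Matrix.vec m (\<lambda>_. ?y)"
  have relu: "map_vec relu (Matrix.vec m (\<lambda>_. - c * (\<Sum>j<d. vec_index x j) + \<beta>)) = ?x"
    by (intro eq_vecI) simp_all
  have sum: "(\<Sum>j<m. vec_index ?x j) = real m * ?y" by simp
  have "realization (spike_network d m c \<beta> k) x
      = realization (const_layer 1 m c 0 # amplifier m c k) ?x"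
    unfolding spike_network_def const_layer_def realization.simps affine_const_layer[OF assms(1)] relu ..
  also have "\<dots> = Matrix.vec 1 (\<lambda>_. c ^ k * real m ^ (k div 2) * (c * (\<Sum>j<m. vec_index ?x j) + 0))"
  proof (rule realization_const_layer_amplifier)
    show "0 \<le> c * (\<Sum>j<m. vec_index ?x j) + 0" unfolding sum using assms by (simp add: relu_def)
  qed (use assms in simp_all)
  also have "\<dots> = Matrix.vec 1 (\<lambda>_. c ^ Suc k * real m ^ (Suc (Suc k) div 2) * ?y)"
    unfolding sum by (simp add: mult_ac)
  finally show ?thesis .
qed

section \<open>Shape and size of the spike networks\<close>

lemma is_network_amplifier:
  assumes "m \<ge> 1"
  shows "amplifier m c k = [] \<or> is_network (amplifier m c k) \<and> d_in (amplifier m c k) = 1"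
  using assms
  by (induction m c k rule: amplifier.induct)
     (simp_all add: is_network_const_layer_Cons d_in_const_layer_Cons)

lemma length_amplifier: "length (amplifier m c k) = k"
  by (induction m c k rule: amplifier.induct) simp_all

lemma d_out_const_layer_amplifier: "d_out (const_layer 1 s a b # amplifier m c k) = 1"
  by (induction m c k arbitrary: s a b rule: amplifier.induct)
     (simp_all add: d_out_def const_layer_def)

lemma l0_mat_const: "l0_mat (Matrix.mat r s (\<lambda>_. a)) \<le> r * s"
proof -
  have "l0_mat (Matrix.mat r s (\<lambda>_. a)) \<le> card ({..<r} \<times> {..<s})"
    unfolding l0_mat_def by (intro card_mono) auto
  then show ?thesis by simp
qed

lemma l0_mat_const_0: "l0_mat (Matrix.mat r s (\<lambda>_. 0)) = 0"
proof -
  have "{(i, j). i < r \<and> j < s \<and> Matrix.mat r s (\<lambda>_. 0 :: real) $$ (i, j) \<noteq> 0} = {}" by auto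
  then show ?thesis unfolding l0_mat_def dim_row_mat dim_col_mat by (simp only: card.empty)
qed

lemma l0_vec_const: "l0_vec (Matrix.vec r (\<lambda>_. a)) \<le> r"
proof -
  have "l0_vec (Matrix.vec r (\<lambda>_. a)) \<le> card {..<r}"
    unfolding l0_vec_def by (intro card_mono) auto
  then show ?thesis by simp
qed

lemma l0_vec_const_0: "l0_vec (Matrix.vec r (\<lambda>_. 0)) = 0"
  unfolding l0_vec_def by auto

lemma num_weights_const_layer_Cons:
  "num_weights (const_layer r s a b # \<Phi>) \<le> r * s + r + num_weights \<Phi>"
  "num_weights (const_layer r s a 0 # \<Phi>) \<le> r * s + num_weights \<Phi>"
  unfolding num_weights_def const_layer_def
  by (simp_all add: l0_mat_const l0_vec_const l0_vec_const_0 add_mono)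

lemma num_weights_amplifier:
  assumes "m \<ge> 1"
  shows "num_weights (amplifier m c k) \<le> k * m"
  using assms
proof (induction m c k rule: amplifier.induct)
  case (1 m c)
  then show ?case by (simp add: num_weights_def)
next
  case (2 m c)
  then show ?case using num_weights_const_layer_Cons(2)[of 1 1 c "[]"] by (simp add: num_weights_def)
next
  case (3 m c k)
  then show ?case
    using num_weights_const_layer_Cons(2)[of m 1 c "const_layer 1 m c 0 # amplifier m c k"]
      num_weights_const_layer_Cons(2)[of 1 m c "amplifier m c k"] by simp
qed

lemma max_const_layer:
  assumes "r \<ge> 1" "s \<ge> 1" "const_layer r s a b = (A, v)"
  shows "max (max_mat A) (max_vec v) = max \<bar>a\<bar> \<bar>b\<bar>"
proof -
  have "elements_mat (Matrix.mat r s (\<lambda>_. a)) = {a}"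
  proof (rule equalityI)
    show "elements_mat (Matrix.mat r s (\<lambda>_. a)) \<subseteq> {a}" by auto
    show "{a} \<subseteq> elements_mat (Matrix.mat r s (\<lambda>_. a))"
      using assms(1,2) elements_matI[of "Matrix.mat r s (\<lambda>_. a)" r s 0 0 a] by simp
  qed
  moreover have "vec_set (Matrix.vec r (\<lambda>_. b)) = {b}"
    using assms(1) by (auto simp: vec_set_def intro: image_eqI[of _ _ 0])
  ultimately show ?thesis
    using assms(3) by (auto simp: const_layer_def max_mat_def max_vec_def)
qed

lemma amplifier_layers:
  assumes "(A, v) \<in> set (amplifier m c k)" "m \<ge> 1" "0 \<le> c"
  shows "max (max_mat A) (max_vec v) \<le> c"
  using assms
proof (induction m c k rule: amplifier.induct)
  case (2 m c)
  then have "const_layer 1 1 c 0 = (A, v)" by simp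
  from max_const_layer[OF _ _ this] show ?case using 2 by simp
next
  case (3 m c k)
  then consider "const_layer m 1 c 0 = (A, v)" | "const_layer 1 m c 0 = (A, v)" | "(A, v) \<in> set (amplifier m c k)"
    by auto
  then show ?case
    using 3 max_const_layer[of m 1 c 0 A v] max_const_layer[of 1 m c 0 A v] by cases auto
qed simp

text \<open>A zero entry costs nothing in the count or in the size of the weights, so a single zero
  layer fits every n and every \<open>c n\<close>. It serves as approximant for small n and as the
  predecessor of the first dyadic approximant.\<close>

lemma zero_in_nn_class:
  assumes "ell n \<ge> 1"
  shows "(\<lambda>_ :: real ^ 'd. 0) \<in> nn_class ell c n"
proof -
  let ?\<Phi> = "[const_layer 1 CARD('d) 0 0]"
  have "vec_index (realization ?\<Phi> (input_vec x)) 0 = 0" for x :: "real ^ 'd"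
    by (simp add: const_layer_def affine_const_layer input_vec_def)
  moreover have "is_network ?\<Phi>" by (simp add: is_network_const_layer_Cons Suc_leI)
  moreover have "d_in ?\<Phi> = CARD('d)" by (rule d_in_const_layer_Cons)
  moreover have "d_out ?\<Phi> = 1" using d_out_const_layer_amplifier[of "CARD('d)" 0 0 0 0 0] by simp
  moreover have "num_weights ?\<Phi> = 0"
    by (simp add: num_weights_def const_layer_def l0_vec_const_0 l0_mat_const_0)
  moreover have "enat (num_layers ?\<Phi>) \<le> ell n"
    using assms by (simp add: num_layers_def one_enat_def)
  moreover have "nn_norm ?\<Phi> = 0"
    using max_const_layer[of 1 "CARD('d)" 0 0] by (simp add: nn_norm_def Suc_leI split: prod.split)
  ultimately show ?thesis
    unfolding nn_class_def
    by (intro CollectI exI[of _ ?\<Phi>]) auto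
qed

text \<open>The budget m * (d + k + 2) consists of m * d weights and m biases in the first layer, m
  weights in the second, and k * m for the amplifier. The bias is admissible because \<beta> \<le> 1
  \<le> C.\<close>

lemma spike_in_nn_class:
  assumes "c n = enat C" "C \<ge> 1" "0 \<le> \<beta>" "\<beta> \<le> 1" "m \<ge> 1"
    and "m * (CARD('d) + k + 2) \<le> n" "enat (k + 2) \<le> ell n"
  shows "(\<lambda>x :: real ^ 'd. real C ^ Suc k * real m ^ (Suc (Suc k) div 2) *
            relu (\<beta> - real C * (\<Sum>i\<in>UNIV. vec_nth x i))) \<in> nn_class ell c n"
proof -
  let ?d = "CARD('d)"
  let ?\<Phi> = "spike_network ?d m (real C) \<beta> k"
  have real: "vec_index (realization ?\<Phi> (input_vec x)) 0 = real C ^ Suc k * real m ^ (Suc (Suc k) div 2) *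
            relu (\<beta> - real C * (\<Sum>i\<in>UNIV. vec_nth x i))" for x :: "real ^ 'd"
  proof -
    have "(\<Sum>j<?d. vec_index (input_vec x) j) = (\<Sum>j<?d. vec_nth x (from_nat_into UNIV j))"
      by (simp add: input_vec_def)
    also have "\<dots> = (\<Sum>i\<in>UNIV. vec_nth x i)" by (rule sum_from_nat_into_UNIV)
    finally show ?thesis
      by (subst realization_spike_network) (simp_all add: input_vec_def)
  qed
  have net: "is_network ?\<Phi>"
    using assms is_network_amplifier[of m "real C" k]
    by (simp add: spike_network_def is_network_const_layer_Cons d_in_const_layer_Cons Suc_leI)
  have din: "d_in ?\<Phi> = ?d" unfolding spike_network_def by (rule d_in_const_layer_Cons)
  have dout: "d_out ?\<Phi> = 1"
    using d_out_const_layer_amplifier[of m "real C" 0 m "real C" k]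
    by (simp add: spike_network_def d_out_def)
  have "num_weights ?\<Phi> \<le> m * ?d + m + (1 * m + k * m)"
    unfolding spike_network_def
    using num_weights_const_layer_Cons(1)[of m ?d "- real C" \<beta> "const_layer 1 m (real C) 0 # amplifier m (real C) k"]
      num_weights_const_layer_Cons(2)[of 1 m "real C" "amplifier m (real C) k"]
      num_weights_amplifier[OF \<open>m \<ge> 1\<close>, of "real C" k] by linarith
  also have "\<dots> = m * (?d + k + 2)" by (simp add: algebra_simps)
  finally have weights: "num_weights ?\<Phi> \<le> n" using assms by linarith
  have layers: "enat (num_layers ?\<Phi>) \<le> ell n"
    using assms by (simp add: num_layers_def spike_network_def length_amplifier)
  have "max (max_mat A) (max_vec v) \<le> real C" if "(A, v) \<in> set ?\<Phi>" for A v
  proof -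
    from that consider "const_layer m ?d (- real C) \<beta> = (A, v)" | "const_layer 1 m (real C) 0 = (A, v)"
      | "(A, v) \<in> set (amplifier m (real C) k)"
      by (auto simp: spike_network_def)
    then show ?thesis
    proof cases
      case 1
      from max_const_layer[OF _ _ this] show ?thesis using assms by (simp add: Suc_leI)
    next
      case 2
      from max_const_layer[OF _ _ this] show ?thesis using assms by simp
    next
      case 3
      from amplifier_layers[OF this] show ?thesis using assms by simp
    qed
  qed
  then have "\<forall>l \<in> set ?\<Phi>. (case l of (A, v) \<Rightarrow> max (max_mat A) (max_vec v)) \<le> real C"
    by (auto simp only: split: prod.split)
  moreover have "set ?\<Phi> \<noteq> {}" by (simp add: spike_network_def)
  ultimately have "nn_norm ?\<Phi> \<le> real C"
    unfolding nn_norm_def by (subst Max_le_iff) auto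
  then have norm: "ennreal (nn_norm ?\<Phi>) \<le> ennreal_of_enat (c n)"
    unfolding assms(1) ennreal_of_enat_enat ennreal_of_nat_eq_real_of_nat by (rule ennreal_leI)
  show ?thesis
    unfolding nn_class_def real[symmetric] using net din dout weights layers norm by blast
qed

section \<open>Growth conditions\<close>

text \<open>The logarithmic power divided by the power of n tends to zero for every real s, negative
  or not, and a convergent sequence is bounded.\<close>

lemma ln_powr_le_powr:
  fixes s \<epsilon> :: real
  assumes "0 < \<epsilon>"
  obtains D where "D > 0" "\<And>n :: nat. n \<ge> 1 \<Longrightarrow> ln (2 * real n) powr s \<le> D * real n powr \<epsilon>"
proof -
  have "(\<lambda>n :: nat. ln (2 * real n) powr s * real n powr (- \<epsilon>)) \<longlonglongrightarrow> 0"
    using assms by real_asymp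
  then have "Bseq (\<lambda>n :: nat. ln (2 * real n) powr s * real n powr (- \<epsilon>))"
    by (intro convergent_imp_Bseq convergentI)
  then obtain D where D: "D > 0" "\<And>n. norm (ln (2 * real n) powr s * real n powr (- \<epsilon>)) \<le> D"
    by (rule BseqE) blast
  show ?thesis
  proof (rule that[OF D(1)])
    fix n :: nat assume n: "n \<ge> 1"
    have "ln (2 * real n) powr s = ln (2 * real n) powr s * real n powr (- \<epsilon>) * real n powr \<epsilon>"
      using n by (simp add: mult.assoc flip: powr_add)
    also have "\<dots> \<le> D * real n powr \<epsilon>"
      using D(2)[of n] by (intro mult_right_mono) auto
    finally show "ln (2 * real n) powr s \<le> D * real n powr \<epsilon>" .
  qed
qed

lemma gamma_star_enat:
  assumes "ell_star ell = enat K" "0 \<le> \<theta>"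
  shows "gamma_star \<theta> ell = ennreal (\<theta> * real K + real (K div 2))"
  using assms
  by (simp add: gamma_star_def enat_half_def ennreal_mult ennreal_plus flip: ennreal_of_nat_eq_real_of_nat)

lemma gamma_star_infinity:
  assumes "ell_star ell = \<infinity>"
  shows "gamma_star \<theta> ell = \<infinity>"
  using assms by (simp add: gamma_star_def enat_half_def)

lemma ell_le_ell_star: "n \<ge> 1 \<Longrightarrow> ell n \<le> ell_star ell"
  unfolding ell_star_def by (rule SUP_upper) simp

text \<open>Every finite depth not above the supremum is reached, also when the supremum is
  infinite, and monotonicity keeps it from there on. The successor turns
  \<open>ell n < enat (Suc L)\<close> into a bound by \<open>enat L\<close>.\<close>

lemma ell_star_attained:
  assumes "enat (Suc L) \<le> ell_star ell" "mono_on {1..} ell"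
  obtains N where "N \<ge> 1" "\<And>n. n \<ge> N \<Longrightarrow> enat (Suc L) \<le> ell n"
proof -
  have "\<exists>N\<ge>1. enat (Suc L) \<le> ell N"
  proof (rule ccontr)
    assume "\<not> ?thesis"
    then have "ell n \<le> enat L" if "n \<ge> 1" for n
    proof -
      have "ell n < enat (Suc L)" using that \<open>\<not> (\<exists>N\<ge>1. enat (Suc L) \<le> ell N)\<close> by (meson not_le)
      then show ?thesis by (cases "ell n") auto
    qed
    then have "ell_star ell \<le> enat L" unfolding ell_star_def by (intro SUP_least) auto
    with assms(1) have "enat (Suc L) \<le> enat L" by (rule order_trans)
    then show False by simp
  qed
  then obtain N where N: "N \<ge> 1" "enat (Suc L) \<le> ell N" by blast
  show ?thesis
  proof (rule that[OF N(1)])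
    fix n assume "n \<ge> N"
    with N(1) have "ell N \<le> ell n" by (intro mono_onD[OF assms(2)]) auto
    with N(2) show "enat (Suc L) \<le> ell n" by (rule order_trans)
  qed
qed

lemma nn_class_mono:
  assumes "n \<le> n'" "ell n \<le> ell n'" "c n \<le> c n'"
  shows "nn_class ell c n \<subseteq> nn_class ell c n'"
proof -
  have "ennreal_of_enat (c n) \<le> ennreal_of_enat (c n')"
    using assms(3) by (simp add: ennreal_of_enat_le_iff)
  then show ?thesis
    unfolding nn_class_def using assms(1,2) by (blast intro: order_trans)
qed

lemma ennreal_of_enat_bounds:
  assumes "0 \<le> u" "ennreal l \<le> ennreal_of_enat e" "ennreal_of_enat e \<le> ennreal u"
  shows "e = enat (the_enat e)" "l \<le> real (the_enat e)" "real (the_enat e) \<le> u"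
proof -
  obtain k where k: "e = enat k" using assms(3) by (cases e) (auto simp: top_unique)
  show "e = enat (the_enat e)" by (simp add: k)
  show "l \<le> real (the_enat e)" "real (the_enat e) \<le> u"
    using assms unfolding k ennreal_of_enat_enat ennreal_of_nat_eq_real_of_nat the_enat.simps
    by (simp_all add: ennreal_le_iff)
qed

text \<open>A finite bound K on the depth makes the constant and the power of the logarithm uniform
  over all networks; the gap between \<gamma> and the exact exponent absorbs the logarithm.\<close>

lemma nn_class_lipschitz_powr:
  fixes \<theta> \<kappa> \<gamma> :: real
  assumes c: "\<And>n. n \<ge> 1 \<Longrightarrow> c n = enat (the_enat (c n)) \<and> c n \<ge> 1 \<and>
      real (the_enat (c n)) \<le> K2 * real n powr \<theta> * ln (2 * real n) powr \<kappa>"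
    and "0 < K2" and K: "ell_star ell = enat K" and \<gamma>: "\<theta> * real K + real (K div 2) < \<gamma>"
  obtains \<Lambda> where "\<Lambda> > 0" "\<And>n (g :: real ^ 'd \<Rightarrow> real). n \<ge> 1 \<Longrightarrow> g \<in> nn_class ell c n \<Longrightarrow> l1_lipschitz (\<Lambda> * real n powr \<gamma>) g"
proof -
  define \<epsilon> where "\<epsilon> = \<gamma> - (\<theta> * real K + real (K div 2))"
  obtain D where D: "D > 0" "\<And>n :: nat. n \<ge> 1 \<Longrightarrow> ln (2 * real n) powr (\<kappa> * real K) \<le> D * real n powr \<epsilon>"
    using ln_powr_le_powr[of \<epsilon> "\<kappa> * real K"] \<gamma> by (auto simp: \<epsilon>_def)
  show ?thesis
  proof (rule that[of "K2 ^ K * D"])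
    show "K2 ^ K * D > 0" using D(1) \<open>0 < K2\<close> by simp
    fix n and g :: "real ^ 'd \<Rightarrow> real"
    assume n: "n \<ge> 1" and g: "g \<in> nn_class ell c n"
    define C where "C = the_enat (c n)"
    have C: "c n = enat C" "C \<ge> 1" "real C \<le> K2 * real n powr \<theta> * ln (2 * real n) powr \<kappa>"
      using c[OF n] by (auto simp: C_def one_enat_def)
        (metis enat_ord_simps(1) the_enat.simps)
    have "c n \<noteq> \<infinity>" using C by simp
    from nn_class_lipschitz[OF g this] obtain L where
      L: "enat L \<le> ell n" "l1_lipschitz (real C ^ L * real n ^ (L div 2)) g"
      unfolding C_def by blast
    have "enat L \<le> enat K" using L(1) ell_le_ell_star[OF n, of ell] unfolding K by (rule order_trans)
    then have LK: "L \<le> K" by simp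
    \<comment> \<open>Since C and n are at least 1, replacing the actual depth by K only enlarges
      the bound.\<close>
    have "real C ^ L * real n ^ (L div 2) \<le> real C ^ K * real n ^ (K div 2)"
      using C(2) n LK by (intro mult_mono power_increasing div_le_mono) auto
    also have "\<dots> \<le> (K2 * real n powr \<theta> * ln (2 * real n) powr \<kappa>) ^ K * real n ^ (K div 2)"
      using C(3) by (intro mult_right_mono power_mono) auto
    also have "\<dots> = K2 ^ K * real n powr (\<theta> * real K + real (K div 2)) * ln (2 * real n) powr (\<kappa> * real K)"
      using n by (simp add: power_mult_distrib powr_add powr_realpow powr_power mult_ac)
    also have "\<dots> \<le> K2 ^ K * real n powr (\<theta> * real K + real (K div 2)) * (D * real n powr \<epsilon>)"
      using D(2)[OF n] \<open>0 < K2\<close> by (intro mult_left_mono) auto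
    also have "\<dots> = K2 ^ K * D * real n powr \<gamma>"
      by (simp add: \<epsilon>_def mult_ac flip: powr_add)
    finally show "l1_lipschitz (K2 ^ K * D * real n powr \<gamma>) g"
      by (rule l1_lipschitz_mono[OF L(2)])
  qed
qed

text \<open>For finite p, the condition m \<le> 2 * n makes the Lipschitz constants of both
  functions comparable to the same power of n. D is left open to receive the quasi-triangle
  constant.\<close>

lemma increment_bound:
  fixes p :: ennreal and \<alpha> \<theta> \<kappa> :: real and ell c :: "nat \<Rightarrow> enat"
  assumes "p > 0" "\<alpha> > 0" "\<theta> \<ge> 0"
    and c: "\<And>n. n \<ge> 1 \<Longrightarrow> c n = enat (the_enat (c n)) \<and> c n \<ge> 1 \<and>
      real (the_enat (c n)) \<le> K2 * real n powr \<theta> * ln (2 * real n) powr \<kappa>"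
    and "0 < K2"
    and less: "of_nat CARD('d) / p * gamma_star \<theta> ell < ennreal \<alpha>"
    and "0 \<le> D"
  obtains \<epsilon> B where "0 < \<epsilon>" "0 \<le> B"
    "\<And>n m (g :: real ^ 'd \<Rightarrow> real) h x. \<lbrakk>1 \<le> n; n \<le> m; m \<le> 2 * n; g \<in> nn_class ell c n; h \<in> nn_class ell c m;
       Lp_cube_norm p (\<lambda>x. h x - g x) \<le> ennreal (D * real n powr (- \<alpha>)); x \<in> unit_cube\<rbrakk>
       \<Longrightarrow> \<bar>h x - g x\<bar> \<le> B * real n powr (- \<epsilon>)"
  using \<open>p > 0\<close>
proof (cases rule: ennreal_pos_cases)
  case 1
  \<comment> \<open>For p = \<infinity> the norm bound of a continuous function is already a
    pointwise one, so \<epsilon> = \<alpha> and B = D.\<close>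
  show ?thesis
  proof (rule that[OF \<open>\<alpha> > 0\<close> \<open>0 \<le> D\<close>])
    fix n m and g h :: "real ^ 'd \<Rightarrow> real" and x :: "real ^ 'd"
    assume n: "1 \<le> n" "n \<le> m" and gh: "g \<in> nn_class ell c n" "h \<in> nn_class ell c m"
      and le: "Lp_cube_norm p (\<lambda>x. h x - g x) \<le> ennreal (D * real n powr (- \<alpha>))" and x: "x \<in> unit_cube"
    have "c n \<noteq> \<infinity>" "c m \<noteq> \<infinity>" using c[of n] c[of m] n by auto
    with gh have "continuous_on unit_cube g" "continuous_on unit_cube h"
      by (meson nn_class_lipschitz l1_lipschitz_continuous)+
    then have "continuous_on unit_cube (\<lambda>x. h x - g x)" by (intro continuous_on_diff)
    from abs_le_by_Lp_norm_infinity[OF this le[unfolded 1] _ x] \<open>0 \<le> D\<close>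
    show "\<bar>h x - g x\<bar> \<le> D * real n powr (- \<alpha>)" by simp
  qed
next
  case (2 q)
  define e where "e = real CARD('d) / q"
  have e: "0 < e" using 2 by (simp add: e_def)
  have dp: "of_nat CARD('d) / p = ennreal e"
    using 2 by (simp add: e_def divide_ennreal flip: ennreal_of_nat_eq_real_of_nat)
      (simp add: ennreal_of_nat_eq_real_of_nat divide_ennreal)
  show ?thesis
  proof (cases "ell_star ell")
    case infinity
    \<comment> \<open>Unbounded depth with finite p makes the threshold infinite, which no \<alpha>
      exceeds.\<close>
    then have "of_nat CARD('d) / p * gamma_star \<theta> ell = \<infinity>"
      using e by (simp add: dp gamma_star_infinity ennreal_mult_top)
    with less show ?thesis by simp
  next
    case (enat K)
    define \<gamma>\<^sub>0 where "\<gamma>\<^sub>0 = \<theta> * real K + real (K div 2)"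
    have \<gamma>\<^sub>0: "0 \<le> \<gamma>\<^sub>0" using \<open>\<theta> \<ge> 0\<close> by (simp add: \<gamma>\<^sub>0_def)
    have "ennreal (e * \<gamma>\<^sub>0) < ennreal \<alpha>"
      using less e \<gamma>\<^sub>0 unfolding dp gamma_star_enat[OF enat \<open>\<theta> \<ge> 0\<close>] \<gamma>\<^sub>0_def[symmetric]
      by (simp add: ennreal_mult)
    then have "e * \<gamma>\<^sub>0 < \<alpha>" using e \<gamma>\<^sub>0 by (simp add: ennreal_less_iff)
    then have "\<gamma>\<^sub>0 < \<alpha> / e" using e by (simp add: field_simps)
    \<comment> \<open>Two exponents are interposed: \<gamma> leaves room for the logarithms in the
      Lipschitz constant, \<beta> is the decay rate of the box side.\<close>
    then obtain \<beta> where \<beta>: "\<gamma>\<^sub>0 < \<beta>" "\<beta> < \<alpha> / e" using dense by blast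
    then obtain \<gamma> where \<gamma>: "\<gamma>\<^sub>0 < \<gamma>" "\<gamma> < \<beta>" using dense by blast
    have \<beta>e: "\<beta> * e < \<alpha>" using \<beta>(2) e by (simp add: field_simps)
    obtain \<Lambda> where \<Lambda>: "\<Lambda> > 0"
      "\<And>n (g :: real ^ 'd \<Rightarrow> real). n \<ge> 1 \<Longrightarrow> g \<in> nn_class ell c n \<Longrightarrow> l1_lipschitz (\<Lambda> * real n powr \<gamma>) g"
      using nn_class_lipschitz_powr[OF c \<open>0 < K2\<close> enat \<gamma>(1)[unfolded \<gamma>\<^sub>0_def]] by blast
    \<comment> \<open>The oscillation term decays with exponent \<beta> - \<gamma>, the L^p term
      with exponent \<alpha> - \<beta> * e; the slower of the two governs the sum.\<close>
    define \<epsilon> where "\<epsilon> = min (\<beta> - \<gamma>) (\<alpha> - \<beta> * e)"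
    \<comment> \<open>The summand 1 comes from g at n, the summand 2 powr \<gamma> from h at m \<le>
      2 * n.\<close>
    define \<Lambda>' where "\<Lambda>' = \<Lambda> * (1 + 2 powr \<gamma>)"
    have \<Lambda>': "0 < \<Lambda>'" using \<Lambda>(1) by (simp add: \<Lambda>'_def add_pos_pos)
    show ?thesis
    proof (rule that[of \<epsilon> "\<Lambda>' * real CARD('d) + D"])
      show "0 < \<epsilon>" using \<gamma> \<beta>e by (simp add: \<epsilon>_def)
      show "0 \<le> \<Lambda>' * real CARD('d) + D" using \<Lambda>' \<open>0 \<le> D\<close> by simp
      fix n m and g h :: "real ^ 'd \<Rightarrow> real" and x :: "real ^ 'd"
      assume n: "1 \<le> n" "n \<le> m" "m \<le> 2 * n" and gh: "g \<in> nn_class ell c n" "h \<in> nn_class ell c m"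
        and le: "Lp_cube_norm p (\<lambda>x. h x - g x) \<le> ennreal (D * real n powr (- \<alpha>))" and x: "x \<in> unit_cube"
      have "real m powr \<gamma> \<le> (2 * real n) powr \<gamma>" using n \<gamma>\<^sub>0 \<gamma> by (intro powr_mono2) auto
      also have "\<dots> = 2 powr \<gamma> * real n powr \<gamma>" by (simp add: powr_mult)
      finally have "\<Lambda> * real m powr \<gamma> \<le> \<Lambda> * (2 powr \<gamma> * real n powr \<gamma>)"
        using \<Lambda>(1) by (intro mult_left_mono) auto
      then have "\<Lambda> * real m powr \<gamma> + \<Lambda> * real n powr \<gamma> \<le> \<Lambda>' * real n powr \<gamma>"
        by (simp add: \<Lambda>'_def algebra_simps)
      moreover have "l1_lipschitz (\<Lambda> * real m powr \<gamma> + \<Lambda> * real n powr \<gamma>) (\<lambda>x. h x - g x)"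
        using n gh by (intro l1_lipschitz_diff \<Lambda>(2)) auto
      ultimately have lip: "l1_lipschitz (\<Lambda>' * real n powr \<gamma>) (\<lambda>x. h x - g x)"
        using l1_lipschitz_mono by blast
      define r where "r = real n powr (- \<beta>)"
      have r: "0 < r" "r \<le> 1"
        using n(1) \<beta>(1) \<gamma>\<^sub>0 by (auto simp: r_def powr_minus inverse_le_1_iff ge_one_powr_ge_zero)
      have "\<bar>h x - g x\<bar> \<le> \<Lambda>' * real n powr \<gamma> * (real CARD('d) * r)
            + r powr (- real CARD('d) / q) * (D * real n powr (- \<alpha>))"
        using abs_le_by_Lp_norm[OF lip _ 2(1) le[unfolded 2(2)] _ x r] \<Lambda>' \<open>0 \<le> D\<close> by simp
      also have "\<Lambda>' * real n powr \<gamma> * (real CARD('d) * r) = \<Lambda>' * real CARD('d) * real n powr (- (\<beta> - \<gamma>))"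
        by (simp add: r_def mult_ac flip: powr_add)
      also have "r powr (- real CARD('d) / q) * (D * real n powr (- \<alpha>)) = D * real n powr (- (\<alpha> - \<beta> * e))"
        by (simp add: r_def powr_powr e_def mult_ac flip: powr_add)
      also have "\<Lambda>' * real CARD('d) * real n powr (- (\<beta> - \<gamma>)) + D * real n powr (- (\<alpha> - \<beta> * e))
          \<le> \<Lambda>' * real CARD('d) * real n powr (- \<epsilon>) + D * real n powr (- \<epsilon>)"
        using \<Lambda>' \<open>0 \<le> D\<close> n(1) by (intro add_mono mult_left_mono powr_mono) (auto simp: \<epsilon>_def)
      finally show "\<bar>h x - g x\<bar> \<le> (\<Lambda>' * real CARD('d) + D) * real n powr (- \<epsilon>)"
        by (simp add: distrib_right)
    qed
  qed
qed

section \<open>The embedding\<close>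

text \<open>The infimum defining the distance need not be attained; the factor 2 buys a strict
  inequality and thereby an actual approximant.\<close>

lemma approx_Gamma_le_1D:
  fixes f :: "real ^ 'd \<Rightarrow> real"
  assumes "approx_Gamma ell c \<alpha> p f \<le> 1" "n \<ge> 1"
  obtains g where "g \<in> nn_class ell c n" "Lp_cube_norm p (\<lambda>x. f x - g x) \<le> ennreal (2 * real n powr (- \<alpha>))"
proof -
  have "ennreal (real n powr \<alpha>) * Lp_dist p f (nn_class ell c n)
      \<le> (SUP n \<in> {1..}. ennreal (real n powr \<alpha>) * Lp_dist p f (nn_class ell c n))"
    using assms(2) by (intro SUP_upper) auto
  also have "\<dots> \<le> 1" using assms(1) by (simp add: approx_Gamma_def)
  finally have le: "ennreal (real n powr \<alpha>) * Lp_dist p f (nn_class ell c n) \<le> 1" .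
  have "Lp_dist p f (nn_class ell c n)
      = ennreal (real n powr (- \<alpha>)) * (ennreal (real n powr \<alpha>) * Lp_dist p f (nn_class ell c n))"
    using assms(2) by (simp flip: mult.assoc ennreal_mult powr_add)
  also have "\<dots> \<le> ennreal (real n powr (- \<alpha>)) * 1"
    by (intro mult_left_mono le) simp
  also have "\<dots> < ennreal (2 * real n powr (- \<alpha>))"
    using assms(2) by (simp add: ennreal_less_iff)
  finally show ?thesis
    unfolding Lp_dist_def INF_less_iff using that by (auto intro: less_imp_le)
qed

text \<open>The point is that A does not depend on f: it is built from the increment constants,
  which are fixed before f is chosen.\<close>

lemma approx_Gamma_le_1_continuous:
  fixes p :: ennreal and \<alpha> \<theta> \<kappa> :: real and ell c :: "nat \<Rightarrow> enat"
  assumes "p > 0" "\<alpha> > 0" "\<theta> \<ge> 0" and ell: "\<And>n. n \<ge> 1 \<Longrightarrow> ell n \<ge> 1"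
    and c: "\<And>n. n \<ge> 1 \<Longrightarrow> c n = enat (the_enat (c n)) \<and> c n \<ge> 1 \<and>
      real (the_enat (c n)) \<le> K2 * real n powr \<theta> * ln (2 * real n) powr \<kappa>"
    and "0 < K2"
    and less: "of_nat CARD('d) / p * gamma_star \<theta> ell < ennreal \<alpha>"
  obtains A where "0 < A"
    "\<And>f :: real ^ 'd \<Rightarrow> real. f \<in> borel_measurable (lebesgue_on unit_cube) \<Longrightarrow> approx_Gamma ell c \<alpha> p f \<le> 1 \<Longrightarrow>
       \<exists>g. continuous_on unit_cube g \<and> (AE x in lebesgue_on unit_cube. g x = f x) \<and> (\<forall>x\<in>unit_cube. \<bar>g x\<bar> \<le> A)"
proof -
  let ?M = "lebesgue_on (unit_cube :: (real ^ 'd) set)"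
  obtain Q where Q: "Q > 0" "\<And>f g a. \<lbrakk>f \<in> borel_measurable ?M; g \<in> borel_measurable ?M; 0 \<le> a; Lp_norm ?M p f \<le> ennreal a;
        Lp_norm ?M p g \<le> ennreal a\<rbrakk> \<Longrightarrow> Lp_norm ?M p (\<lambda>x. f x - g x) \<le> ennreal (Q * a)"
    using Lp_norm_quasi_triangle[OF \<open>p > 0\<close>, where M = ?M] by blast
  have D: "0 \<le> 2 * Q" using Q(1) by simp
  obtain \<epsilon> B where \<epsilon>: "0 < \<epsilon>" and B: "0 \<le> B"
    "\<And>n m (g :: real ^ 'd \<Rightarrow> real) h x. \<lbrakk>1 \<le> n; n \<le> m; m \<le> 2 * n; g \<in> nn_class ell c n; h \<in> nn_class ell c m;
       Lp_cube_norm p (\<lambda>x. h x - g x) \<le> ennreal (2 * Q * real n powr (- \<alpha>)); x \<in> unit_cube\<rbrakk>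
       \<Longrightarrow> \<bar>h x - g x\<bar> \<le> B * real n powr (- \<epsilon>)"
    using increment_bound[OF assms(1-3) c \<open>0 < K2\<close> less D] by blast
  define \<rho> where "\<rho> = (2 :: real) powr (- \<epsilon>)"
  have \<rho>: "0 \<le> \<rho>" "\<rho> < 1" using \<epsilon> powr_less_mono[of "- \<epsilon>" 0 2] by (simp_all add: \<rho>_def)
  have geo: "(\<lambda>k. B * \<rho> ^ k) sums (B * (1 / (1 - \<rho>)))"
    using \<rho> by (intro sums_mult geometric_sums) auto
  show ?thesis
  \<comment> \<open>B bounds the first approximant, the geometric series bounds the sum of all
    increments, and the final 1 ensures positivity when B = 0.\<close>
  proof (rule that[of "B + B * (1 / (1 - \<rho>)) + 1"])
    show "0 < B + B * (1 / (1 - \<rho>)) + 1" using B(1) \<rho> by (simp add: add_nonneg_pos)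
    fix f :: "real ^ 'd \<Rightarrow> real"
    assume f[measurable]: "f \<in> borel_measurable ?M" and Gamma: "approx_Gamma ell c \<alpha> p f \<le> 1"
    have "\<exists>g. g \<in> nn_class ell c n \<and> Lp_cube_norm p (\<lambda>x. f x - g x) \<le> ennreal (2 * real n powr (- \<alpha>))"
      if "n \<ge> 1" for n
      using approx_Gamma_le_1D[OF Gamma that] by blast
    then obtain G where G: "\<And>n. n \<ge> 1 \<Longrightarrow> G n \<in> nn_class ell c n"
      "\<And>n. n \<ge> 1 \<Longrightarrow> Lp_cube_norm p (\<lambda>x. f x - G n x) \<le> ennreal (2 * real n powr (- \<alpha>))"
      by metis
    define h where "h k = G (2 ^ k)" for k :: nat
    have one: "1 \<le> (2 :: nat) ^ k" for k by simp
    have h: "h k \<in> nn_class ell c (2 ^ k)"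
      "Lp_cube_norm p (\<lambda>x. f x - h k x) \<le> ennreal (2 * real (2 ^ k) powr (- \<alpha>))" for k
      unfolding h_def by (intro G one)+
    have h_cont: "continuous_on unit_cube (h k)" for k
    proof -
      have "c (2 ^ k) \<noteq> \<infinity>" using c[OF one[of k]] by auto
      from nn_class_lipschitz[OF h(1) this] show ?thesis by (meson l1_lipschitz_continuous)
    qed
    have [measurable]: "h k \<in> borel_measurable ?M" for k
      by (rule continuous_measurable_unit_cube[OF h_cont])
    have pow: "real (2 ^ k) powr (- \<epsilon>) = \<rho> ^ k" for k
      by (simp add: \<rho>_def powr_power powr_powr mult.commute flip: powr_realpow)
    have incr: "\<bar>h (Suc k) x - h k x\<bar> \<le> B * \<rho> ^ k" if "x \<in> unit_cube" for k x
    proof -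
      \<comment> \<open>The finer approximant is also given the coarser accuracy, so that both
        errors have the common bound required by the quasi-triangle inequality.\<close>
      have "real (2 ^ Suc k) powr (- \<alpha>) \<le> real (2 ^ k) powr (- \<alpha>)"
        using \<open>\<alpha> > 0\<close> by (intro powr_mono2') auto
      then have "Lp_cube_norm p (\<lambda>x. f x - h (Suc k) x) \<le> ennreal (2 * real (2 ^ k) powr (- \<alpha>))"
        by (intro order_trans[OF h(2)] ennreal_leI) simp
      with h(2)[of k] have "Lp_cube_norm p (\<lambda>x. (f x - h k x) - (f x - h (Suc k) x))
          \<le> ennreal (Q * (2 * real (2 ^ k) powr (- \<alpha>)))"
        by (intro Q(2)) auto
      then have "Lp_cube_norm p (\<lambda>x. h (Suc k) x - h k x) \<le> ennreal (2 * Q * real (2 ^ k) powr (- \<alpha>))"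
        by (simp add: mult_ac)
      from B(2)[OF one _ _ h(1) h(1) this that] show ?thesis unfolding pow by simp
    qed
    \<comment> \<open>The zero network plays the preceding approximant: the norm of f is at most 1,
      so h 0 is bounded in L^p and the increment bound with n = m = 1 applies.\<close>
    have h0: "\<bar>h 0 x\<bar> \<le> B" if "x \<in> unit_cube" for x
    proof -
      have "Lp_cube_norm p f \<le> 1" using Gamma by (simp add: approx_Gamma_def)
      also have "\<dots> \<le> ennreal 2" by (metis ennreal_1 ennreal_leI one_le_numeral)
      finally have "Lp_cube_norm p (\<lambda>x. f x - (f x - h 0 x)) \<le> ennreal (Q * 2)"
        using h(2)[of 0] by (intro Q(2)) auto
      then have "Lp_cube_norm p (\<lambda>x. h 0 x - 0) \<le> ennreal (2 * Q * real 1 powr (- \<alpha>))"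
        by (simp add: mult_ac)
      moreover have "(\<lambda>_. 0) \<in> nn_class ell c 1" by (rule zero_in_nn_class[OF ell]) simp
      ultimately show ?thesis using B(2)[of 1 1 "\<lambda>_. 0" "h 0" x] h(1)[of 0] that by simp
    qed
    define s where "s x = (\<Sum>k. h (Suc k) x - h k x)" for x
    have unif: "uniform_limit unit_cube (\<lambda>n x. \<Sum>k<n. h (Suc k) x - h k x) s sequentially"
      unfolding s_def
      by (rule Weierstrass_m_test[where M = "\<lambda>k. B * \<rho> ^ k"]) (use incr geo in \<open>auto simp: sums_iff\<close>)
    have tele: "(\<Sum>k<n. h (Suc k) x - h k x) = h n x - h 0 x" for n x
      using sum_lessThan_telescope[of "\<lambda>k. h k x"] by simp
    have s_cont: "continuous_on unit_cube s"
      by (rule uniform_limit_theorem[OF _ unif]) (auto intro!: always_eventually continuous_intros h_cont)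
    define g where "g x = h 0 x + s x" for x
    have g_cont: "continuous_on unit_cube g"
      unfolding g_def by (intro continuous_intros h_cont s_cont)
    have [measurable]: "g \<in> borel_measurable ?M" by (rule continuous_measurable_unit_cube[OF g_cont])
    have "\<bar>g x\<bar> \<le> B + B * (1 / (1 - \<rho>)) + 1" if "x \<in> unit_cube" for x
    proof -
      have "summable (\<lambda>k. \<bar>h (Suc k) x - h k x\<bar>)"
        by (rule summable_comparison_test'[of "\<lambda>k. B * \<rho> ^ k" 0]) (use geo incr[OF that] in \<open>auto simp: sums_iff\<close>)
      then have "\<bar>s x\<bar> \<le> (\<Sum>k. \<bar>h (Suc k) x - h k x\<bar>)"
        unfolding s_def by (rule summable_rabs)
      also have "\<dots> \<le> (\<Sum>k. B * \<rho> ^ k)"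
        using \<open>summable _\<close> geo incr[OF that] by (intro suminf_le) (auto simp: sums_iff)
      also have "\<dots> = B * (1 / (1 - \<rho>))" using geo by (simp add: sums_iff)
      finally show ?thesis using h0[OF that] unfolding g_def by linarith
    qed
    moreover have "AE x in ?M. g x = f x"
    proof -
      \<comment> \<open>The limit is identified with f: some h k is uniformly close to g and close
        to f in L^p. Taking \<delta> = \<eta> / Q cancels the quasi-triangle constant.\<close>
      have "Lp_cube_norm p (\<lambda>x. f x - g x) \<le> 0 + ennreal \<eta>" if "\<eta> > 0" for \<eta>
      proof -
        define \<delta> where "\<delta> = \<eta> / Q"
        have \<delta>: "\<delta> > 0" "Q * \<delta> = \<eta>" using that Q(1) by (auto simp: \<delta>_def)
        have "\<forall>\<^sub>F k in sequentially. \<forall>x\<in>unit_cube. dist (\<Sum>j<k. h (Suc j) x - h j x) (s x) < \<delta>"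
          using unif \<delta>(1) unfolding uniform_limit_iff by blast
        moreover have "(\<lambda>k. 2 * real (2 ^ k) powr (- \<alpha>)) \<longlonglongrightarrow> 0"
          using \<open>\<alpha> > 0\<close> by real_asymp
        then have "\<forall>\<^sub>F k in sequentially. 2 * real (2 ^ k) powr (- \<alpha>) < \<delta>"
          using \<delta>(1) by (rule order_tendstoD)
        ultimately have "\<forall>\<^sub>F k in sequentially. (\<forall>x\<in>unit_cube. dist (\<Sum>j<k. h (Suc j) x - h j x) (s x) < \<delta>) \<and>
            2 * real (2 ^ k) powr (- \<alpha>) < \<delta>"
          by (rule eventually_conj)
        then obtain k where k: "\<And>x. x \<in> unit_cube \<Longrightarrow> dist (\<Sum>j<k. h (Suc j) x - h j x) (s x) < \<delta>"
            "2 * real (2 ^ k) powr (- \<alpha>) < \<delta>"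
          unfolding eventually_sequentially by blast
        have "\<bar>g x - h k x\<bar> \<le> \<delta>" if "x \<in> unit_cube" for x
          using k(1)[OF that] unfolding tele by (simp add: g_def dist_real_def abs_minus_commute algebra_simps)
        then have "Lp_cube_norm p (\<lambda>x. g x - h k x) \<le> ennreal \<delta>"
          using \<open>p > 0\<close> \<delta> by (intro Lp_cube_norm_le_sup) auto
        moreover have "Lp_cube_norm p (\<lambda>x. f x - h k x) \<le> ennreal \<delta>"
          using k(2) by (intro order_trans[OF h(2)] ennreal_leI) simp
        ultimately have "Lp_cube_norm p (\<lambda>x. (f x - h k x) - (g x - h k x)) \<le> ennreal (Q * \<delta>)"
          using \<delta>(1) by (intro Q(2)) auto
        then show ?thesis using \<delta>(2) by simp
      qed
      then have "Lp_cube_norm p (\<lambda>x. f x - g x) \<le> 0"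
        by (rule ennreal_le_epsilon)
      then have "AE x in ?M. f x - g x = 0"
        using \<open>p > 0\<close> by (intro Lp_norm_0_AE[of p]) auto
      then show ?thesis by (auto elim!: eventually_mono)
    qed
    ultimately show "\<exists>g. continuous_on unit_cube g \<and> (AE x in ?M. g x = f x) \<and>
        (\<forall>x\<in>unit_cube. \<bar>g x\<bar> \<le> B + B * (1 / (1 - \<rho>)) + 1)"
      using g_cont by blast
  qed
qed

lemma approx_space_embeds:
  fixes p :: ennreal and ell c :: "nat \<Rightarrow> enat"
  assumes "0 < A"
    and unit: "\<And>f :: real ^ 'd \<Rightarrow> real. f \<in> borel_measurable (lebesgue_on unit_cube) \<Longrightarrow> approx_Gamma ell c \<alpha> p f \<le> 1 \<Longrightarrow>
       \<exists>g. continuous_on unit_cube g \<and> (AE x in lebesgue_on unit_cube. g x = f x) \<and> (\<forall>x\<in>unit_cube. \<bar>g x\<bar> \<le> A)"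
  shows "embeds (approx_space ell c \<alpha> p :: (real ^ 'd \<Rightarrow> real) set) (approx_norm ell c \<alpha> p) cont_cube sup_norm"
  unfolding embeds_def
proof (intro exI[of _ A] conjI ballI \<open>0 < A\<close>)
  fix f :: "real ^ 'd \<Rightarrow> real"
  assume "f \<in> approx_space ell c \<alpha> p"
  then have f[measurable]: "f \<in> borel_measurable (lebesgue_on unit_cube)"
    and fin: "approx_norm ell c \<alpha> p f < \<infinity>"
    by (auto simp: approx_space_def Lp_cube_def)
  let ?T = "{t :: real. t > 0 \<and> approx_Gamma ell c \<alpha> p (\<lambda>x. f x / t) \<le> 1}"
  have version: "\<exists>g. continuous_on unit_cube g \<and> (AE x in lebesgue_on unit_cube. g x = f x) \<and>
      (\<forall>x\<in>unit_cube. \<bar>g x\<bar> \<le> A * t)" if "t \<in> ?T" for t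
  proof -
    have "(\<lambda>x. f x / t) \<in> borel_measurable (lebesgue_on unit_cube)" by measurable
    with unit[of "\<lambda>x. f x / t"] that obtain g where g: "continuous_on unit_cube g"
      "AE x in lebesgue_on unit_cube. g x = f x / t" "\<And>x. x \<in> unit_cube \<Longrightarrow> \<bar>g x\<bar> \<le> A"
      by blast
    have "continuous_on unit_cube (\<lambda>x. t * g x)" using g(1) by (intro continuous_intros)
    moreover have "AE x in lebesgue_on unit_cube. t * g x = f x"
      using g(2) that by (auto elim!: eventually_mono)
    moreover have "\<bar>t * g x\<bar> \<le> A * t" if "x \<in> unit_cube" for x
      using g(3)[OF that] \<open>t \<in> ?T\<close> by (simp add: abs_mult mult.commute)
    ultimately show ?thesis by blast
  qed
  from fin obtain t0 where "t0 \<in> ?T"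
    unfolding approx_norm_def by (auto simp: INF_less_iff)
  with version obtain g where g: "continuous_on unit_cube g" "AE x in lebesgue_on unit_cube. g x = f x"
    by blast
  have sup: "sup_norm g \<le> ennreal (A * t)" if t: "t \<in> ?T" for t
  proof -
    obtain g' where g': "continuous_on unit_cube g'" "AE x in lebesgue_on unit_cube. g' x = f x"
      "\<And>x. x \<in> unit_cube \<Longrightarrow> \<bar>g' x\<bar> \<le> A * t"
      using version[OF t] by blast
    have "AE x in lebesgue_on unit_cube. g x = g' x" using g(2) g'(2) by eventually_elim simp
    then have "g x = g' x" if "x \<in> unit_cube" for x
      using AE_unit_cube_continuous_eq[OF g(1) g'(1)] that by blast
    then show ?thesis unfolding sup_norm_def by (intro SUP_least ennreal_leI) (simp add: g'(3))
  qed
  \<comment> \<open>Dividing by A makes the left side a lower bound of the set whose infimum is the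
    norm.\<close>
  have "sup_norm g / ennreal A \<le> approx_norm ell c \<alpha> p f"
    unfolding approx_norm_def
  proof (rule INF_greatest)
    fix t assume t: "t \<in> ?T"
    then have "0 < t" by simp
    have "sup_norm g / ennreal A \<le> ennreal (A * t) / ennreal A"
      using sup[OF t] by (rule divide_right_mono_ennreal)
    also have "\<dots> = ennreal t" using \<open>0 < A\<close> \<open>0 < t\<close> by (simp add: divide_ennreal)
    finally show "sup_norm g / ennreal A \<le> ennreal t" .
  qed
  then have "ennreal A * (sup_norm g / ennreal A) \<le> ennreal A * approx_norm ell c \<alpha> p f"
    by (rule mult_left_mono) simp
  also have "ennreal A * (sup_norm g / ennreal A) = sup_norm g"
    using \<open>0 < A\<close> by (simp add: ennreal_times_divide ennreal_mult_divide_eq mult.commute)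
  finally have "sup_norm g \<le> ennreal A * approx_norm ell c \<alpha> p f" .
  with g show "\<exists>g\<in>cont_cube. (AE x in lebesgue_on unit_cube. g x = f x) \<and>
      sup_norm g \<le> ennreal A * approx_norm ell c \<alpha> p f"
    by (auto simp: cont_cube_def)
qed

text \<open>On the cube the coordinates are non-negative, so the spike is at most Q * \<beta> and
  vanishes once a coordinate exceeds \<beta> / C. The condition \<beta> \<le> C keeps the box of
  side \<beta> / C inside the cube.\<close>

lemma Lp_cube_norm_spike:
  fixes Q \<beta> q :: real
  assumes "0 \<le> Q" "0 \<le> \<beta>" "\<beta> \<le> C" "0 < C" "0 < q"
  shows "Lp_cube_norm (ennreal q) (\<lambda>x :: real ^ 'd. Q * relu (\<beta> - C * (\<Sum>i\<in>UNIV. vec_nth x i)))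
       \<le> ennreal (Q * \<beta> * (\<beta> / C) powr (real CARD('d) / q))"
proof -
  let ?f = "\<lambda>x :: real ^ 'd. Q * relu (\<beta> - C * (\<Sum>i\<in>UNIV. vec_nth x i))"
  let ?M = "lebesgue_on (unit_cube :: (real ^ 'd) set)"
  define r where "r = \<beta> / C"
  have r: "0 \<le> r" "r \<le> 1" using assms by (auto simp: r_def)
  define B where "B = cbox (0 :: real ^ 'd) (\<chi> i. vec_nth (0 :: real ^ 'd) i + r)"
  have sub: "B \<subseteq> unit_cube"
  proof
    fix x assume "x \<in> B"
    then have "0 \<le> vec_nth x i" "vec_nth x i \<le> r" for i by (auto simp: B_def mem_box_cart)
    with r(2) show "x \<in> unit_cube" unfolding mem_box_cart by (auto intro: order_trans)
  qed
  have em: "emeasure ?M B = ennreal (r ^ CARD('d))"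
    unfolding B_def using r sub by (intro emeasure_lebesgue_on_unit_cube) (auto simp: B_def)
  have B: "B \<in> sets ?M" using sub by (subst sets_restrict_space_iff) (auto simp: B_def)
  have pw: "\<bar>?f x\<bar> powr q \<le> (Q * \<beta>) powr q * indicator B x" if x: "x \<in> unit_cube" for x
  proof -
    have nonneg: "0 \<le> vec_nth x i" for i using x by (auto simp: mem_box_cart)
    then have sum: "0 \<le> (\<Sum>i\<in>UNIV. vec_nth x i)" by (intro sum_nonneg) auto
    show ?thesis
    proof (cases "x \<in> B")
      case True
      have "\<bar>?f x\<bar> \<le> Q * \<beta>"
        using assms sum by (auto simp: relu_def abs_mult intro!: mult_left_mono)
      then show ?thesis using True assms by (auto intro!: powr_mono2)
    next
      case False
      then obtain i where "r < vec_nth x i" using nonneg by (auto simp: B_def mem_box_cart not_le)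
      also have "\<dots> \<le> (\<Sum>i\<in>UNIV. vec_nth x i)"
        by (rule member_le_sum) (use nonneg in auto)
      finally have "\<beta> \<le> C * (\<Sum>i\<in>UNIV. vec_nth x i)" using assms by (simp add: r_def field_simps)
      then show ?thesis by (simp add: relu_def)
    qed
  qed
  have "(\<integral>\<^sup>+ x. ennreal (\<bar>?f x\<bar> powr q) \<partial>?M) \<le> (\<integral>\<^sup>+ x. ennreal ((Q * \<beta>) powr q) * indicator B x \<partial>?M)"
  proof (rule nn_integral_mono)
    fix x assume "x \<in> space ?M"
    then have "x \<in> unit_cube" by (simp add: space_restrict_space)
    from ennreal_leI[OF pw[OF this]]
    show "ennreal (\<bar>?f x\<bar> powr q) \<le> ennreal ((Q * \<beta>) powr q) * indicator B x"
      by (auto simp: indicator_def split: if_splits)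
  qed
  also have "\<dots> = ennreal ((Q * \<beta>) powr q * r ^ CARD('d))"
    using B r by (simp add: nn_integral_cmult_indicator em ennreal_mult)
  also have "(Q * \<beta>) powr q * r ^ CARD('d) = (Q * \<beta> * r powr (real CARD('d) / q)) powr q"
  proof (cases "r = 0")
    case False
    then show ?thesis using assms r by (simp add: powr_mult powr_powr powr_realpow)
  qed simp
  finally show ?thesis
    unfolding r_def using assms by (subst Lp_norm_le_iff) auto
qed

section \<open>Failure of the embedding\<close>

text \<open>From N on, f is its own approximant and the distance vanishes. Below N the zero network
  leaves an error of at most \<delta>, and n powr \<alpha> is at most N powr \<alpha>, so the single
  inequality at N controls all n.\<close>

lemma approx_Gamma_le_1I:
  fixes f :: "real ^ 'd \<Rightarrow> real"
  assumes "0 < q" "0 < \<alpha>" "0 \<le> \<delta>" and N: "N \<ge> 1" "real N powr \<alpha> * \<delta> \<le> 1"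
    and le: "Lp_cube_norm (ennreal q) f \<le> ennreal \<delta>"
    and cls: "\<And>n. n \<ge> N \<Longrightarrow> f \<in> nn_class ell c n"
    and ell: "\<And>n. n \<ge> 1 \<Longrightarrow> ell n \<ge> 1"
  shows "approx_Gamma ell c \<alpha> (ennreal q) f \<le> 1"
proof -
  have "1 * \<delta> \<le> real N powr \<alpha> * \<delta>"
    using N(1) \<open>0 < \<alpha>\<close> \<open>0 \<le> \<delta>\<close> by (intro mult_right_mono ge_one_powr_ge_zero) auto
  then have "\<delta> \<le> 1" using N(2) by simp
  then have "Lp_cube_norm (ennreal q) f \<le> 1"
    using le by (metis ennreal_1 ennreal_leI order_trans)
  moreover have "ennreal (real n powr \<alpha>) * Lp_dist (ennreal q) f (nn_class ell c n) \<le> 1" if "n \<ge> 1" for n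
  proof (cases "n < N")
    case True
    have "Lp_dist (ennreal q) f (nn_class ell c n) \<le> Lp_cube_norm (ennreal q) (\<lambda>x. f x - 0)"
      unfolding Lp_dist_def using zero_in_nn_class ell that by (intro INF_lower) blast
    also have "\<dots> \<le> ennreal \<delta>" using le by simp
    finally have "ennreal (real n powr \<alpha>) * Lp_dist (ennreal q) f (nn_class ell c n)
        \<le> ennreal (real N powr \<alpha>) * ennreal \<delta>"
      using True \<open>0 < \<alpha>\<close> by (intro mult_mono ennreal_leI powr_mono2) auto
    also have "\<dots> = ennreal (real N powr \<alpha> * \<delta>)" using \<open>0 \<le> \<delta>\<close> by (simp add: ennreal_mult)
    also have "\<dots> \<le> ennreal 1" by (rule ennreal_leI[OF N(2)])
    finally show ?thesis by simp
  next
    case False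
    then have "Lp_dist (ennreal q) f (nn_class ell c n) \<le> Lp_cube_norm (ennreal q) (\<lambda>x. f x - f x)"
      unfolding Lp_dist_def by (intro INF_lower cls) simp
    also have "\<dots> \<le> ennreal 0" using \<open>0 < q\<close> by (subst Lp_norm_le_iff) simp_all
    finally show ?thesis by simp
  qed
  ultimately show ?thesis
    unfolding approx_Gamma_def by (auto intro: SUP_least)
qed

text \<open>The height a stays fixed while the slope Q * C grows with the number m of parallel
  neurons. The L^p norm, of order (Q * C) powr (- d / q), then falls below N powr (-
  \<alpha>).\<close>

lemma tall_spike:
  fixes \<alpha> \<theta> \<kappa> q a :: real and ell c :: "nat \<Rightarrow> enat"
  assumes "0 < q" "0 < \<alpha>" "0 < K1" "0 < a"
    and c: "\<And>n. n \<ge> 1 \<Longrightarrow> c n = enat (the_enat (c n)) \<and> c n \<ge> 1 \<and>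
      K1 * real n powr \<theta> * ln (2 * real n) powr \<kappa> \<le> real (the_enat (c n))"
    and mono: "mono_on {1..} ell" "mono_on {1..} c"
    and ell: "\<And>n. n \<ge> 1 \<Longrightarrow> ell n \<ge> 1"
    and N0: "\<And>n. n \<ge> N0 \<Longrightarrow> enat (k + 2) \<le> ell n"
    and less: "\<alpha> < real CARD('d) / q * (\<theta> * real (k + 2) + real ((k + 2) div 2))"
  obtains f :: "real ^ 'd \<Rightarrow> real" where "continuous_on UNIV f" "f 0 = a" "approx_Gamma ell c \<alpha> (ennreal q) f \<le> 1"
proof -
  let ?d = "CARD('d)"
  define L where "L = k + 2"
  define H where "H = L div 2"
  define e where "e = real ?d / q"
  define \<gamma> where "\<gamma> = \<theta> * real L + real H"
  define R where "R = ?d + L"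
  have e: "0 < e" using \<open>0 < q\<close> by (simp add: e_def)
  have R: "R \<ge> 1" by (simp add: R_def L_def)
  have H: "H \<ge> 1" by (simp add: H_def L_def)
  \<comment> \<open>Half of the gap is spent on the logarithm; the other half remains as the factor
    N powr (- \<epsilon>) that beats the constant \<open>J\<close>.\<close>
  define \<epsilon> where "\<epsilon> = (\<gamma> * e - \<alpha>) / 2"
  have \<epsilon>: "0 < \<epsilon>" using less by (simp add: \<epsilon>_def \<gamma>_def e_def L_def H_def mult.commute)
  obtain D where D: "D > 0" "\<And>n :: nat. n \<ge> 1 \<Longrightarrow> ln (2 * real n) powr (- \<kappa> * real L * e) \<le> D * real n powr \<epsilon>"
    using ln_powr_le_powr[OF \<epsilon>, of "- \<kappa> * real L * e"] by blast
  \<comment> \<open>\<open>J\<close> gathers all factors independent of m; R ^ H appears because m =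
    N / R.\<close>
  define J where "J = a * a powr e * (K1 ^ L / real R ^ H) powr (- e) * D"
  have "(\<lambda>m. J * real (m * R) powr (- \<epsilon>)) \<longlonglongrightarrow> 0"
    using \<epsilon> R by real_asymp
  then have "\<forall>\<^sub>F m in sequentially. J * real (m * R) powr (- \<epsilon>) < 1"
    by (rule order_tendstoD) simp
  moreover have "\<forall>\<^sub>F m in sequentially. m \<ge> max 1 (max N0 (nat \<lceil>a\<rceil>))"
    by (rule eventually_ge_at_top)
  ultimately have "\<forall>\<^sub>F m in sequentially. J * real (m * R) powr (- \<epsilon>) < 1 \<and> m \<ge> max 1 (max N0 (nat \<lceil>a\<rceil>))"
    by (rule eventually_conj)
  then obtain m where m: "J * real (m * R) powr (- \<epsilon>) < 1" "m \<ge> max 1 (max N0 (nat \<lceil>a\<rceil>))"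
    unfolding eventually_sequentially by blast
  have m1: "m \<ge> 1" "m \<ge> N0" "a \<le> real m" using m(2) by linarith+
  \<comment> \<open>This is exactly the weight budget of the spike with m parallel neurons and depth
    L.\<close>
  define N where "N = m * R"
  have "m \<le> N" using R by (simp add: N_def)
  then have N: "N \<ge> 1" "N \<ge> N0" using m1 by linarith+
  define C where "C = the_enat (c N)"
  have C: "c N = enat C" "C \<ge> 1" "K1 * real N powr \<theta> * ln (2 * real N) powr \<kappa> \<le> real C"
    using c[OF N(1)] by (auto simp: C_def one_enat_def) (metis enat_ord_simps(1) the_enat.simps)
  define Q where "Q = real C ^ Suc k * real m ^ H"
  have "1 * real m ^ 1 \<le> Q"
    unfolding Q_def using C(2) m1 H by (intro mult_mono power_increasing one_le_power) auto
  then have Q: "real m \<le> Q" "0 < Q" "a \<le> Q" using m1 by auto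
  \<comment> \<open>This bias makes the value at the origin equal to a. The choice m \<ge> a gives Q
    \<ge> a, hence \<beta> \<le> 1, which every weight bound C \<ge> 1 admits.\<close>
  define \<beta> where "\<beta> = a / Q"
  have \<beta>: "0 < \<beta>" "\<beta> \<le> 1" "Q * \<beta> = a"
    using Q \<open>0 < a\<close> by (auto simp: \<beta>_def)
  have \<beta>C: "\<beta> \<le> real C" using \<beta>(2) C(2) by linarith
  define f where "f = (\<lambda>x :: real ^ 'd. Q * relu (\<beta> - real C * (\<Sum>i\<in>UNIV. vec_nth x i)))"
  define \<delta> where "\<delta> = a * (\<beta> / real C) powr e"
  have cls: "f \<in> nn_class ell c n" if "n \<ge> N" for n
  proof -
    have "f \<in> nn_class ell c N"
      unfolding f_def Q_def H_def L_def add_2_eq_Suc'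
      by (rule spike_in_nn_class) (use C(1,2) \<beta> m1 N0[OF N(2)] in \<open>auto simp: N_def R_def L_def add.assoc\<close>)
    moreover have "nn_class ell c N \<subseteq> (nn_class ell c n :: (real ^ 'd \<Rightarrow> real) set)"
      using that N(1) by (intro nn_class_mono mono_onD[OF mono(1)] mono_onD[OF mono(2)]) auto
    ultimately show ?thesis by blast
  qed
  have Lp: "Lp_cube_norm (ennreal q) f \<le> ennreal \<delta>"
    using Lp_cube_norm_spike[of Q \<beta> "real C" q, where 'd = 'd] Q \<beta> \<beta>C C(2) \<open>0 < q\<close>
    unfolding f_def \<delta>_def e_def by simp
  have small: "real N powr \<alpha> * \<delta> \<le> 1"
  proof -
    have lnN: "0 < ln (2 * real N)" using N(1) by simp
    have split: "(W * (u powr \<gamma> * v powr (\<kappa> * real L))) powr (- e)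
        = W powr (- e) * (u powr (- (\<gamma> * e)) * v powr (- \<kappa> * real L * e))"
      if "0 \<le> W" "0 \<le> u" "0 \<le> v" for W u v :: real
      using that by (simp add: powr_mult powr_powr)
    have "K1 ^ L / real R ^ H * (real N powr \<gamma> * ln (2 * real N) powr (\<kappa> * real L))
        = (K1 * real N powr \<theta> * ln (2 * real N) powr \<kappa>) ^ L * real m ^ H"
      using N(1) m1 R lnN
      by (simp add: N_def \<gamma>_def power_mult_distrib powr_add powr_realpow powr_power powr_mult mult_ac)
    also have "\<dots> \<le> real C ^ L * real m ^ H"
      using C(3) \<open>0 < K1\<close> by (intro mult_right_mono power_mono) auto
    also have "\<dots> = Q * real C" by (simp add: Q_def L_def)
    finally have QC: "K1 ^ L / real R ^ H * (real N powr \<gamma> * ln (2 * real N) powr (\<kappa> * real L)) \<le> Q * real C" .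
    have "\<delta> = a * a powr e * (Q * real C) powr (- e)"
      using \<open>0 < a\<close> Q(2) C(2) by (simp add: \<delta>_def \<beta>_def powr_minus powr_mult divide_inverse inverse_powr)
    also have "\<dots> \<le> a * a powr e * (K1 ^ L / real R ^ H * (real N powr \<gamma> * ln (2 * real N) powr (\<kappa> * real L))) powr (- e)"
      using QC e \<open>0 < a\<close> \<open>0 < K1\<close> N(1) R lnN by (intro mult_left_mono powr_mono2') auto
    also have "\<dots> = a * a powr e * (K1 ^ L / real R ^ H) powr (- e) *
        (real N powr (- (\<gamma> * e)) * ln (2 * real N) powr (- \<kappa> * real L * e))"
      using \<open>0 < K1\<close> N(1) lnN by (subst split) auto
    also have "\<dots> \<le> a * a powr e * (K1 ^ L / real R ^ H) powr (- e) *
        (real N powr (- (\<gamma> * e)) * (D * real N powr \<epsilon>))"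
      using D(2)[OF N(1)] \<open>0 < a\<close> by (intro mult_left_mono) auto
    also have "\<dots> = J * real N powr (\<epsilon> - \<gamma> * e)"
      by (simp add: J_def mult_ac flip: powr_add)
    finally have "real N powr \<alpha> * \<delta> \<le> real N powr \<alpha> * (J * real N powr (\<epsilon> - \<gamma> * e))"
      by (rule mult_left_mono) simp
    also have "\<dots> = J * real N powr (- \<epsilon>)"
    proof -
      have "\<alpha> + (\<epsilon> - \<gamma> * e) = - \<epsilon>" by (simp add: \<epsilon>_def field_simps)
      then show ?thesis by (metis mult.left_commute powr_add)
    qed
    also have "\<dots> \<le> 1" using m(1) by (simp add: N_def)
    finally show ?thesis .
  qed
  show ?thesis
  proof (rule that)
    show "continuous_on UNIV f" unfolding f_def relu_def by (intro continuous_intros)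
    show "f 0 = a" using \<beta> by (simp add: f_def relu_def)
    show "approx_Gamma ell c \<alpha> (ennreal q) f \<le> 1"
      by (rule approx_Gamma_le_1I[OF \<open>0 < q\<close> \<open>0 < \<alpha>\<close> _ N(1) small Lp cls ell])
         (use \<open>0 < a\<close> in \<open>simp add: \<delta>_def\<close>)
  qed
qed

text \<open>The spikes are continuous and lie in both spaces. Their continuous version is unique on
  the cube, so its value at the corner 0 can exceed any proposed embedding constant.\<close>

lemma not_embeds_approx_space:
  assumes spikes: "\<And>a. a > 0 \<Longrightarrow> \<exists>f :: real ^ 'd \<Rightarrow> real. continuous_on UNIV f \<and> f 0 = a \<and> approx_Gamma ell c \<alpha> p f \<le> 1"
  shows "\<not> embeds (approx_space ell c \<alpha> p :: (real ^ 'd \<Rightarrow> real) set) (approx_norm ell c \<alpha> p) cont_cube sup_norm"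
proof
  assume "embeds (approx_space ell c \<alpha> p :: (real ^ 'd \<Rightarrow> real) set) (approx_norm ell c \<alpha> p) cont_cube sup_norm"
  then obtain A where A: "A > 0" "\<And>f :: real ^ 'd \<Rightarrow> real. f \<in> approx_space ell c \<alpha> p \<Longrightarrow>
      \<exists>g\<in>cont_cube. (AE x in lebesgue_on unit_cube. g x = f x) \<and> sup_norm g \<le> ennreal A * approx_norm ell c \<alpha> p f"
    unfolding embeds_def by blast
  have "A + 1 > 0" using A(1) by simp
  from spikes[OF this] obtain f :: "real ^ 'd \<Rightarrow> real" where f: "continuous_on UNIV f" "f 0 = A + 1"
    "approx_Gamma ell c \<alpha> p f \<le> 1" by blast
  have fc: "continuous_on unit_cube f" using f(1) by (rule continuous_on_subset) simp
  have norm: "approx_norm ell c \<alpha> p f \<le> ennreal 1"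
    unfolding approx_norm_def using f(3) by (intro INF_lower) auto
  have "Lp_cube_norm p f \<le> 1" using f(3) by (simp add: approx_Gamma_def)
  then have "Lp_cube_norm p f < \<infinity>" "approx_norm ell c \<alpha> p f < \<infinity>"
    using norm by (auto elim: le_less_trans)
  then have "f \<in> approx_space ell c \<alpha> p"
    using continuous_measurable_unit_cube[OF fc] by (simp add: approx_space_def Lp_cube_def)
  from A(2)[OF this] obtain g where g: "continuous_on unit_cube g" "AE x in lebesgue_on unit_cube. g x = f x"
    "sup_norm g \<le> ennreal A * approx_norm ell c \<alpha> p f"
    by (auto simp: cont_cube_def)
  have zero: "(0 :: real ^ 'd) \<in> unit_cube" by (simp add: mem_box_cart)
  have "g 0 = f 0" using AE_unit_cube_continuous_eq[OF g(1) fc g(2) zero] .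
  then have "ennreal (A + 1) \<le> sup_norm g"
    unfolding sup_norm_def using zero A(1) f(2) by (intro SUP_upper2[of 0]) auto
  also have "\<dots> \<le> ennreal A * ennreal 1"
    using g(3) by (rule order_trans) (intro mult_left_mono norm, simp)
  finally show False using A(1) by (simp add: ennreal_le_iff)
qed

theorem theorem1p1:
  fixes p :: ennreal and \<alpha> \<theta> \<kappa> :: real and ell c :: "nat \<Rightarrow> enat"
  assumes "p > 0" and "\<alpha> > 0"
    and "\<forall>n\<ge>1. ell n \<ge> 2" and "mono_on {1..} ell"
    and "\<forall>n\<ge>1. c n \<ge> 1" and "mono_on {1..} c"
    and "\<theta> \<ge> 0"
    and "\<exists>K1 > 0. \<exists>K2 > 0. \<forall>n\<ge>1.
           ennreal (K1 * real n powr \<theta> * ln (2 * real n) powr \<kappa>) \<le> ennreal_of_enat (c n) \<and>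
           ennreal_of_enat (c n) \<le> ennreal (K2 * real n powr \<theta> * ln (2 * real n) powr \<kappa>)"
  shows "(ennreal \<alpha> > of_nat CARD('d) / p * gamma_star \<theta> ell \<longrightarrow>
            embeds (approx_space ell c \<alpha> p :: (real ^ 'd \<Rightarrow> real) set) (approx_norm ell c \<alpha> p)
                   cont_cube sup_norm) \<and>
         (ennreal \<alpha> < of_nat CARD('d) / p * gamma_star \<theta> ell \<longrightarrow>
            \<not> embeds (approx_space ell c \<alpha> p :: (real ^ 'd \<Rightarrow> real) set) (approx_norm ell c \<alpha> p)
                     cont_cube sup_norm)"
proof (intro conjI impI)
  obtain K1 K2 where K: "K1 > 0" "K2 > 0" "\<And>n. n \<ge> 1 \<Longrightarrow>
           ennreal (K1 * real n powr \<theta> * ln (2 * real n) powr \<kappa>) \<le> ennreal_of_enat (c n) \<and>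
           ennreal_of_enat (c n) \<le> ennreal (K2 * real n powr \<theta> * ln (2 * real n) powr \<kappa>)"
    using assms(8) by blast
  have c: "c n = enat (the_enat (c n))" "c n \<ge> 1"
    "K1 * real n powr \<theta> * ln (2 * real n) powr \<kappa> \<le> real (the_enat (c n))"
    "real (the_enat (c n)) \<le> K2 * real n powr \<theta> * ln (2 * real n) powr \<kappa>" if n: "n \<ge> 1" for n
  proof -
    have "0 \<le> K2 * real n powr \<theta> * ln (2 * real n) powr \<kappa>" using K(2) by simp
    from ennreal_of_enat_bounds[OF this conjunct1[OF K(3)[OF n]] conjunct2[OF K(3)[OF n]]]
    show "c n = enat (the_enat (c n))" "K1 * real n powr \<theta> * ln (2 * real n) powr \<kappa> \<le> real (the_enat (c n))"
      "real (the_enat (c n)) \<le> K2 * real n powr \<theta> * ln (2 * real n) powr \<kappa>" .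
    show "c n \<ge> 1" using assms(5) n by blast
  qed
  have ell: "ell n \<ge> 1" if "n \<ge> 1" for n
  proof -
    have "(1 :: enat) \<le> 2" by simp
    also have "2 \<le> ell n" using assms(3) that by blast
    finally show ?thesis .
  qed
  {
    assume less: "of_nat CARD('d) / p * gamma_star \<theta> ell < ennreal \<alpha>"
    have "c n = enat (the_enat (c n)) \<and> c n \<ge> 1 \<and>
      real (the_enat (c n)) \<le> K2 * real n powr \<theta> * ln (2 * real n) powr \<kappa>" if "n \<ge> 1" for n
      using c[OF that] by blast
    from approx_Gamma_le_1_continuous[OF assms(1,2,7) ell this K(2) less]
    obtain A where "0 < A"
    "\<And>f :: real ^ 'd \<Rightarrow> real. f \<in> borel_measurable (lebesgue_on unit_cube) \<Longrightarrow> approx_Gamma ell c \<alpha> p f \<le> 1 \<Longrightarrow>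
       \<exists>g. continuous_on unit_cube g \<and> (AE x in lebesgue_on unit_cube. g x = f x) \<and> (\<forall>x\<in>unit_cube. \<bar>g x\<bar> \<le> A)"
      by blast
    then show "embeds (approx_space ell c \<alpha> p :: (real ^ 'd \<Rightarrow> real) set) (approx_norm ell c \<alpha> p)
                   cont_cube sup_norm"
      by (rule approx_space_embeds)
  next
    assume less: "ennreal \<alpha> < of_nat CARD('d) / p * gamma_star \<theta> ell"
    \<comment> \<open>For p = \<infinity> the factor d / p is 0, so the hypothesis would read
      \<alpha> < 0.\<close>
    have "p \<noteq> \<infinity>" using less by auto
    then obtain q where q: "0 < q" "p = ennreal q"
      using ennreal_pos_cases[OF assms(1)] by metis
    define e where "e = real CARD('d) / q"
    have e: "0 < e" using q by (simp add: e_def)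
    have dp: "of_nat CARD('d) / p = ennreal e"
      using q by (simp add: e_def ennreal_of_nat_eq_real_of_nat divide_ennreal)
    \<comment> \<open>The spikes need one fixed finite depth whose exponent already exceeds
      \<alpha>; a finite supremum is itself such a depth.\<close>
    have "\<exists>k. enat (k + 2) \<le> ell_star ell \<and> \<alpha> < e * (\<theta> * real (k + 2) + real ((k + 2) div 2))"
    proof (cases "ell_star ell")
      case (enat K)
      have "2 \<le> ell 1" using assms(3) by simp
      also have "\<dots> \<le> ell_star ell" by (rule ell_le_ell_star) simp
      finally have "2 \<le> K" by (simp add: enat numeral_eq_enat)
      then obtain k where k: "K = k + 2" by (metis add.commute le_Suc_ex)
      have "ennreal \<alpha> < ennreal (e * (\<theta> * real K + real (K div 2)))"
        using less e assms(7) unfolding dp gamma_star_enat[OF enat assms(7)]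
        by (simp add: ennreal_mult)
      then have "\<alpha> < e * (\<theta> * real K + real (K div 2))"
        using assms(2) by (simp add: ennreal_less_iff)
      then show ?thesis using enat k by auto
    next
      case infinity
      \<comment> \<open>As \<theta> may be 0, only the halved depth is used: depth 2 * j + 2
        contributes j + 1 through its half.\<close>
      obtain j :: nat where "\<alpha> / e < real j" using reals_Archimedean2 by blast
      then have "\<alpha> < e * real j" using e by (simp add: field_simps)
      also have "\<dots> \<le> e * (\<theta> * real (2 * j + 2) + real ((2 * j + 2) div 2))"
        using e assms(7) by (intro mult_left_mono) auto
      finally show ?thesis using infinity by (intro exI[of _ "2 * j"]) simp
    qed
    then obtain k where k: "enat (k + 2) \<le> ell_star ell"
      "\<alpha> < e * (\<theta> * real (k + 2) + real ((k + 2) div 2))" by blast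
    have "enat (Suc (k + 1)) \<le> ell_star ell" using k(1) by simp
    from ell_star_attained[OF this assms(4)] obtain N0 where
      N0: "\<And>n. n \<ge> N0 \<Longrightarrow> enat (k + 2) \<le> ell n" by auto
    have c': "c n = enat (the_enat (c n)) \<and> c n \<ge> 1 \<and>
      K1 * real n powr \<theta> * ln (2 * real n) powr \<kappa> \<le> real (the_enat (c n))" if "n \<ge> 1" for n
      using c[OF that] by blast
    show "\<not> embeds (approx_space ell c \<alpha> p :: (real ^ 'd \<Rightarrow> real) set) (approx_norm ell c \<alpha> p)
                     cont_cube sup_norm"
    proof (rule not_embeds_approx_space)
      fix a :: real assume a: "a > 0"
      from tall_spike[OF q(1) assms(2) K(1) a c' assms(4,6) ell N0 k(2)[unfolded e_def]]
      show "\<exists>f :: real ^ 'd \<Rightarrow> real. continuous_on UNIV f \<and> f 0 = a \<and> approx_Gamma ell c \<alpha> p f \<le> 1"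
        unfolding q(2) by blast
    qed
  }
qed

end
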